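(* Let $k$ be an algebraically closed field of characteristic not $2$ and let $H_8$ be the $8$-dimensional Kac--Paljutkin algebra over $k$, identified as an algebra with the group algebra $kD_8$, $D_8=\langle t,w\mid t^2=w^4=1,\ tw=w^{-1}t\rangle$. If $f$ is a Hopf algebra automorphism of $H_8$, then $f$ is one of the Hopf algebra automorphisms $\mathrm{id}_{H_8}$, $f_+$, $f_-$, $f_{+-}:=f_+\circ f_-$, where $f_\pm$ are defined by $f_\pm(w)=w^{-1}$, $f_\pm(t)=w^{\pm1}t$. Therefore the group $\mathrm{Aut}(H_8)$ of Hopf algebra automorphisms is $$\mathrm{Aut}(H_8)=\{\mathrm{id}_{H_8},f_+,f_-,f_{+-}\}\cong\mathbb{Z}/2\mathbb{Z}\oplus\mathbb{Z}/2\mathbb{Z}.$$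
   Context: $H_8$ is the Hopf algebra whose underlying algebra is $kD_8$ and whose structure maps are determined by $\Delta(t)=w^{-1}t\otimes e_1t+t\otimes e_0t$, $\Delta(w)=w\otimes e_0w+w^{-1}\otimes e_1w$, $\varepsilon(t)=\varepsilon(w)=1$, $S(t)=(e_0-e_1w)t$, $S(w)=w$, where $e_0=\frac{1+w^2}{2}$, $e_1=\frac{1-w^2}{2}$. Equivalently, $H_8$ is generated by $x_{11},x_{12},x_{21},x_{22}$ with relations $x_{11}^2=x_{22}^2$, $x_{12}^2=x_{21}^2$, $x_{ij}x_{lm}=0$ for $i-j\not\equiv l-m\pmod2$, $x_{11}^2+x_{12}^2=1$, $x_{11}x_{22}=x_{22}x_{11}$, $x_{21}x_{12}=-x_{12}x_{21}$, with $\Delta(x_{ij})=x_{i1}\otimes x_{1j}+x_{i2}\otimes x_{2j}$, $\varepsilon(x_{ij})=\delta_{ij}$, $S(x_{ij})=x_{ji}^3$; the identification is $t=x_{12}+x_{22}$, $w=x_{11}x_{22}-x_{21}x_{12}$. *)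

theory Defs
  imports
    "HOL-Algebra.Elementary_Groups"
    "HOL-Computational_Algebra.Polynomial"
    "HOL-Library.Poly_Mapping"
    "HOL-Library.Numeral_Type"
    "HOL-Library.Product_Plus"
begin

section \<open>The dihedral group of order 8\<close>

text \<open>
  \<open>Rot i\<close> is \<open>w\<^sup>i\<close> and \<open>Refl i\<close> is \<open>w\<^sup>i t\<close>. The group is written additively (although it is
  not commutative), because the multiplication of \<open>'g \<Rightarrow>\<^sub>0 'k\<close> is the convolution
  product for an additive monoid \<open>'g\<close>; thus \<open>d8 \<Rightarrow>\<^sub>0 'k\<close> is the group algebra \<open>kD\<^sub>8\<close>.
\<close>

datatype d8 = Rot 4 | Refl 4

lemma UNIV_4: "(UNIV :: 4 set) = {0, 1, 2, 3}"
proof (rule sym, rule card_subset_eq)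
  show "card {0, 1, 2, 3 :: 4} = card (UNIV :: 4 set)"
    by simp
qed simp_all

lemma UNIV_d8: "(UNIV :: d8 set) = Rot ` UNIV \<union> Refl ` UNIV"
  by (auto intro: d8.exhaust)

instance d8 :: finite
  by standard (simp add: UNIV_d8)

lemma card_d8: "CARD(d8) = 8"
proof -
  have "card (Rot ` UNIV \<union> Refl ` UNIV) = card (range Rot) + card (range Refl)"
    by (rule card_Un_disjoint) auto
  then show ?thesis
    by (simp add: UNIV_d8 card_image inj_on_def)
qed

instantiation d8 :: group_add
begin

definition zero_d8 :: d8 where "0 = Rot 0"

fun plus_d8 :: "d8 \<Rightarrow> d8 \<Rightarrow> d8" where
  "Rot i + Rot j = Rot (i + j)"
| "Rot i + Refl j = Refl (i + j)"
| "Refl i + Rot j = Refl (i - j)"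
| "Refl i + Refl j = Rot (i - j)"

fun uminus_d8 :: "d8 \<Rightarrow> d8" where
  "- Rot i = Rot (- i)"
| "- Refl i = Refl i"

definition minus_d8 :: "d8 \<Rightarrow> d8 \<Rightarrow> d8" where "x - y = x + (- y :: d8)"

instance
proof
  fix a b c :: d8
  show "a + b + c = a + (b + c)"
    by (cases a; cases b; cases c) (simp_all add: algebra_simps)
  show "0 + a = a" "a + 0 = a" "- a + a = 0"
    by (cases a; simp add: zero_d8_def)+
  show "a + - b = a - b"
    by (simp add: minus_d8_def)
qed

end


section \<open>Group algebras, linear extension and tensor products\<close>

definition scale :: "'k::semiring_0 \<Rightarrow> ('g \<Rightarrow>\<^sub>0 'k) \<Rightarrow> ('g \<Rightarrow>\<^sub>0 'k)" where
  "scale c p = Poly_Mapping.map ((*) c) p"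

lemma lookup_scale [simp]: "Poly_Mapping.lookup (scale c p) x = c * Poly_Mapping.lookup p x"
  by (simp add: scale_def Poly_Mapping.map.rep_eq when_def)

lemma scale_eq_mult: "scale c p = Poly_Mapping.single 0 c * (p :: 'g::monoid_add \<Rightarrow>\<^sub>0 'k::semiring_0)"
  by (simp add: scale_def mult_map_scale_conv_mult)

lemma poly_mapping_sum_singles:
  "p = (\<Sum>x\<in>UNIV. Poly_Mapping.single x (Poly_Mapping.lookup p x))"
  for p :: "'g::finite \<Rightarrow>\<^sub>0 'k::comm_monoid_add"
  by (rule poly_mapping_eqI) (simp add: lookup_sum lookup_single when_def)

lemma vector_space_scale: "vector_space (scale :: 'k::field \<Rightarrow> ('g \<Rightarrow>\<^sub>0 'k) \<Rightarrow> _)"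
  by standard (auto intro!: poly_mapping_eqI simp: lookup_add algebra_simps)

text \<open>
  With \<open>kG = ('a \<Rightarrow>\<^sub>0 'k)\<close> and \<open>kH = ('b \<Rightarrow>\<^sub>0 'k)\<close>, the tensor product \<open>kG \<otimes> kH\<close> is realised as
  the group algebra \<open>'a \<times> 'b \<Rightarrow>\<^sub>0 'k\<close> of the product group: \<open>g \<otimes> h\<close> is the basis vector
  \<open>(g, h)\<close>, and the convolution product is the product of the tensor product algebra.
\<close>

definition tensor ::
  "('a::finite \<Rightarrow>\<^sub>0 'k::semiring_0) \<Rightarrow> ('b::finite \<Rightarrow>\<^sub>0 'k) \<Rightarrow> ('a \<times> 'b \<Rightarrow>\<^sub>0 'k)"
  (infixr \<open>\<otimes>\<^sub>k\<close> 70) where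
  "p \<otimes>\<^sub>k q = (\<Sum>x\<in>UNIV. \<Sum>y\<in>UNIV.
     Poly_Mapping.single (x, y) (Poly_Mapping.lookup p x * Poly_Mapping.lookup q y))"

lemma lookup_tensor:
  "Poly_Mapping.lookup (p \<otimes>\<^sub>k q) (x, y) = Poly_Mapping.lookup p x * Poly_Mapping.lookup q y"
proof -
  have "Poly_Mapping.lookup (p \<otimes>\<^sub>k q) (x, y) =
    (\<Sum>a\<in>UNIV. \<Sum>b\<in>UNIV. if a = x \<and> b = y
       then Poly_Mapping.lookup p a * Poly_Mapping.lookup q b else 0)"
    by (simp add: tensor_def lookup_sum lookup_single when_def)
  also have "\<dots> = (\<Sum>a\<in>UNIV. if a = x then
      (\<Sum>b\<in>UNIV. if b = y then Poly_Mapping.lookup p a * Poly_Mapping.lookup q b else 0) else 0)"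
    by (intro sum.cong) auto
  finally show ?thesis
    by simp
qed

lemma tensor_add_left: "(p + q) \<otimes>\<^sub>k r = p \<otimes>\<^sub>k r + q \<otimes>\<^sub>k r"
  and tensor_add_right: "r \<otimes>\<^sub>k (p + q) = r \<otimes>\<^sub>k p + r \<otimes>\<^sub>k q"
  and tensor_zero_left: "0 \<otimes>\<^sub>k r = 0"
  and tensor_zero_right: "r \<otimes>\<^sub>k 0 = 0"
  by (rule poly_mapping_eqI; clarsimp simp: lookup_tensor lookup_add distrib_left distrib_right)+

lemma tensor_minus_left: "(- p) \<otimes>\<^sub>k r = - (p \<otimes>\<^sub>k r)"
  and tensor_minus_right: "r \<otimes>\<^sub>k (- p) = - (r \<otimes>\<^sub>k p)"
  for p :: "'a::finite \<Rightarrow>\<^sub>0 'k::ring"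
  by (rule poly_mapping_eqI; clarsimp simp: lookup_tensor)+

lemma tensor_sum_left: "finite A \<Longrightarrow> sum f A \<otimes>\<^sub>k r = (\<Sum>x\<in>A. f x \<otimes>\<^sub>k r)"
  by (induction rule: finite_induct) (simp_all add: tensor_zero_left tensor_add_left)

lemma tensor_sum_right: "finite A \<Longrightarrow> r \<otimes>\<^sub>k sum f A = (\<Sum>x\<in>A. r \<otimes>\<^sub>k f x)"
  by (induction rule: finite_induct) (simp_all add: tensor_zero_right tensor_add_right)

lemma tensor_single:
  "Poly_Mapping.single x a \<otimes>\<^sub>k Poly_Mapping.single y b = Poly_Mapping.single (x, y) (a * b)"
  by (rule poly_mapping_eqI; clarsimp simp: lookup_tensor lookup_single when_def)

lemma tensor_one: "1 \<otimes>\<^sub>k 1 = (1 :: 'a::{finite, monoid_add} \<times> 'b::{finite, monoid_add} \<Rightarrow>\<^sub>0 'k::semiring_1)"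
  by (simp add: tensor_single zero_prod_def flip: single_one)

lemma tensor_mult_tensor:
  fixes p r :: "'a::{finite, monoid_add} \<Rightarrow>\<^sub>0 'k::comm_semiring_1"
    and q s :: "'b::{finite, monoid_add} \<Rightarrow>\<^sub>0 'k"
  shows "(p \<otimes>\<^sub>k q) * (r \<otimes>\<^sub>k s) = (p * r) \<otimes>\<^sub>k (q * s)"
proof -
  let ?p = "Poly_Mapping.lookup p" and ?q = "Poly_Mapping.lookup q"
  let ?r = "Poly_Mapping.lookup r" and ?s = "Poly_Mapping.lookup s"
  have single: "(Poly_Mapping.single x a \<otimes>\<^sub>k Poly_Mapping.single y b) *
      (Poly_Mapping.single u c \<otimes>\<^sub>k Poly_Mapping.single v d) =
      (Poly_Mapping.single x a * Poly_Mapping.single u c) \<otimes>\<^sub>k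
      (Poly_Mapping.single y b * Poly_Mapping.single v d)"
    for x u :: 'a and y v :: 'b and a b c d :: 'k
    by (simp add: tensor_single mult_single mult_ac)
  have 1: "(Poly_Mapping.single x a \<otimes>\<^sub>k Poly_Mapping.single y b) *
      (Poly_Mapping.single u c \<otimes>\<^sub>k s) =
      (Poly_Mapping.single x a * Poly_Mapping.single u c) \<otimes>\<^sub>k (Poly_Mapping.single y b * s)"
    for x u :: 'a and y :: 'b and a b c :: 'k
    by (subst (1 2) poly_mapping_sum_singles[of s])
      (simp only: tensor_sum_right finite sum_distrib_left single)
  have 2: "(Poly_Mapping.single x a \<otimes>\<^sub>k Poly_Mapping.single y b) * (r \<otimes>\<^sub>k s) =
      (Poly_Mapping.single x a * r) \<otimes>\<^sub>k (Poly_Mapping.single y b * s)"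
    for x :: 'a and y :: 'b and a b :: 'k
    by (subst (1 2) poly_mapping_sum_singles[of r])
      (simp only: tensor_sum_left finite sum_distrib_left 1)
  have 3: "(Poly_Mapping.single x a \<otimes>\<^sub>k q) * (r \<otimes>\<^sub>k s) =
      (Poly_Mapping.single x a * r) \<otimes>\<^sub>k (q * s)"
    for x :: 'a and a :: 'k
    by (subst (1 2) poly_mapping_sum_singles[of q])
      (simp only: tensor_sum_right finite sum_distrib_right 2)
  show ?thesis
    by (subst (1 2) poly_mapping_sum_singles[of p])
      (simp only: tensor_sum_left finite sum_distrib_right 3)
qed

definition tensor_map ::
  "(('a::finite \<Rightarrow>\<^sub>0 'k) \<Rightarrow> ('c::finite \<Rightarrow>\<^sub>0 'k)) \<Rightarrow>
   (('b::finite \<Rightarrow>\<^sub>0 'k) \<Rightarrow> ('d::finite \<Rightarrow>\<^sub>0 'k)) \<Rightarrow>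
   ('a \<times> 'b \<Rightarrow>\<^sub>0 'k::semiring_1) \<Rightarrow> ('c \<times> 'd \<Rightarrow>\<^sub>0 'k)" where
  "tensor_map f g r = (\<Sum>x\<in>UNIV. \<Sum>y\<in>UNIV. scale (Poly_Mapping.lookup r (x, y))
     (f (Poly_Mapping.single x 1) \<otimes>\<^sub>k g (Poly_Mapping.single y 1)))"

lemma linear_lookup:
  fixes f :: "('a::finite \<Rightarrow>\<^sub>0 'k::field) \<Rightarrow> ('c \<Rightarrow>\<^sub>0 'k)"
  assumes "Vector_Spaces.linear scale scale f"
  shows "Poly_Mapping.lookup (f p) c = (\<Sum>x\<in>UNIV. Poly_Mapping.lookup p x *
    Poly_Mapping.lookup (f (Poly_Mapping.single x 1)) c)"
proof -
  interpret f: Vector_Spaces.linear scale scale f by fact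
  have *: "Poly_Mapping.single x c = scale c (Poly_Mapping.single x (1::'k))" for c and x :: 'a
    by (rule poly_mapping_eqI) (simp add: lookup_single when_def)
  have "f p = f (\<Sum>x\<in>UNIV. scale (Poly_Mapping.lookup p x) (Poly_Mapping.single x 1))"
    by (subst poly_mapping_sum_singles, subst *) (rule refl)
  then show ?thesis
    by (simp add: f.sum f.scale lookup_sum)
qed

lemma tensor_map_tensor:
  fixes f :: "('a::finite \<Rightarrow>\<^sub>0 'k::field) \<Rightarrow> ('c::finite \<Rightarrow>\<^sub>0 'k)"
    and g :: "('b::finite \<Rightarrow>\<^sub>0 'k) \<Rightarrow> ('d::finite \<Rightarrow>\<^sub>0 'k)"
  assumes "Vector_Spaces.linear scale scale f" "Vector_Spaces.linear scale scale g"
  shows "tensor_map f g (p \<otimes>\<^sub>k q) = f p \<otimes>\<^sub>k g q"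
proof (rule poly_mapping_eqI)
  fix z :: "'c \<times> 'd"
  obtain c d where z: "z = (c, d)" by (cases z)
  show "Poly_Mapping.lookup (tensor_map f g (p \<otimes>\<^sub>k q)) z = Poly_Mapping.lookup (f p \<otimes>\<^sub>k g q) z"
    unfolding z lookup_tensor linear_lookup[OF assms(1), of p] linear_lookup[OF assms(2), of q]
    by (simp add: tensor_map_def lookup_sum lookup_tensor sum_product mult_ac)
qed

text \<open>
  Linear extension of a map on basis elements to \<open>kD\<^sub>8\<close>. The target is an
  associative \<open>k\<close>-algebra, given by a ring and its unit map \<open>\<eta>\<close>: for a group algebra
  \<open>\<eta> = Poly_Mapping.single 0\<close>, for \<open>k\<close> itself \<open>\<eta> = id\<close>.
\<close>

definition lin_ext :: "('k::field \<Rightarrow> 'a::ring_1) \<Rightarrow> (d8 \<Rightarrow> 'a) \<Rightarrow> (d8 \<Rightarrow>\<^sub>0 'k) \<Rightarrow> 'a" where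
  "lin_ext \<eta> \<phi> p = (\<Sum>x\<in>UNIV. \<eta> (Poly_Mapping.lookup p x) * \<phi> x)"

text \<open>\<open>Rep_bit0 :: 4 \<Rightarrow> int\<close> is the representative in \<open>{0..<4}\<close>.\<close>

abbreviation expo :: "4 \<Rightarrow> nat" where "expo i \<equiv> nat (Rep_bit0 i)"

text \<open>
  \<open>alg_ext \<eta> T W\<close> is the algebra homomorphism with \<open>t \<mapsto> T\<close>, \<open>w \<mapsto> W\<close>, and \<open>anti_ext \<eta> T W\<close> is
  the algebra anti-homomorphism with these values, provided \<open>T\<close>, \<open>W\<close> satisfy the corresponding
  relations; see \<open>alg_ext_hom\<close> and \<open>anti_ext_hom\<close>.
\<close>

fun eval_d8 :: "'a::monoid_mult \<Rightarrow> 'a \<Rightarrow> d8 \<Rightarrow> 'a" where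
  "eval_d8 T W (Rot i) = W ^ expo i"
| "eval_d8 T W (Refl i) = W ^ expo i * T"

fun anti_eval_d8 :: "'a::monoid_mult \<Rightarrow> 'a \<Rightarrow> d8 \<Rightarrow> 'a" where
  "anti_eval_d8 T W (Rot i) = W ^ expo i"
| "anti_eval_d8 T W (Refl i) = T * W ^ expo i"

definition alg_ext where "alg_ext \<eta> T W = lin_ext \<eta> (eval_d8 T W)"

definition anti_ext where "anti_ext \<eta> T W = lin_ext \<eta> (anti_eval_d8 T W)"


definition unit_map :: "('k::field \<Rightarrow> 'a::ring_1) \<Rightarrow> bool" where
  "unit_map \<eta> \<longleftrightarrow> (\<forall>a b. \<eta> (a + b) = \<eta> a + \<eta> b) \<and> (\<forall>a b. \<eta> (a * b) = \<eta> a * \<eta> b) \<and>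
     \<eta> 1 = 1 \<and> (\<forall>a x. \<eta> a * x = x * \<eta> a)"

lemma unit_map_id: "unit_map id"
  by (simp add: unit_map_def mult.commute)

lemma single_0_central:
  "Poly_Mapping.single 0 a * x = x * Poly_Mapping.single 0 a"
  for x :: "'g::{finite, monoid_add} \<Rightarrow>\<^sub>0 'k::field"
proof -
  have "Poly_Mapping.single 0 a * (\<Sum>y\<in>UNIV. Poly_Mapping.single y (Poly_Mapping.lookup x y)) =
      (\<Sum>y\<in>UNIV. Poly_Mapping.single y (Poly_Mapping.lookup x y)) * Poly_Mapping.single 0 a"
    by (simp add: sum_distrib_left sum_distrib_right mult_single mult.commute)
  then show ?thesis
    by (simp only: poly_mapping_sum_singles [symmetric])
qed

lemma unit_map_single:
  "unit_map (Poly_Mapping.single 0 :: 'k::field \<Rightarrow> ('g::{finite, monoid_add} \<Rightarrow>\<^sub>0 'k))"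
  by (simp add: unit_map_def single_add mult_single single_0_central)

lemma pow_mod_4:
  assumes "(W::'a::monoid_mult) ^ 4 = 1"
  shows "W ^ (n mod 4) = W ^ n"
proof -
  have "W ^ n = W ^ (4 * (n div 4) + n mod 4)" by simp
  also have "\<dots> = W ^ (n mod 4)" by (simp only: power_add power_mult assms) simp
  finally show ?thesis by simp
qed

lemma int_expo: "int (expo i) = Rep_bit0 i"
  using Rep_bit0[of i] by simp

lemma expo_add: "expo (i + j) = (expo i + expo j) mod 4"
proof -
  have "int (expo (i + j)) = (int (expo i) + int (expo j)) mod 4"
    unfolding int_expo by (simp add: plus_bit0_def Abs_bit0'_code)
  also have "\<dots> = int ((expo i + expo j) mod 4)"
    by (simp only: zmod_int of_nat_add of_nat_numeral)
  finally show ?thesis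
    by (simp only: of_nat_eq_iff)
qed

lemma expo_diff: "expo (i - j) = (expo i + 3 * expo j) mod 4"
proof -
  have "int (expo (i - j)) = (int (expo i) - int (expo j)) mod 4"
    unfolding int_expo by (simp add: minus_bit0_def Abs_bit0'_code)
  also have "\<dots> = ((int (expo i) + 3 * int (expo j)) + 4 * (- int (expo j))) mod 4"
    by simp
  also have "\<dots> = (int (expo i) + 3 * int (expo j)) mod 4"
    by (rule mod_mult_self2)
  also have "\<dots> = int ((expo i + 3 * expo j) mod 4)"
    by (simp only: zmod_int of_nat_add of_nat_mult of_nat_numeral)
  finally show ?thesis
    by (simp only: of_nat_eq_iff)
qed

lemma expo_0 [simp]: "expo 0 = 0" and expo_1 [simp]: "expo 1 = 1"
  by (simp_all add: bit0.Rep_0 bit0.Rep_1)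

lemma eval_d8_add:
  fixes T W :: "'a::monoid_mult"
  assumes T: "T * T = 1" and W: "W ^ 4 = 1" and TW: "T * W = W ^ 3 * T"
  shows "eval_d8 T W (x + y) = eval_d8 T W x * eval_d8 T W y"
proof -
  have comm: "T * W ^ n = W ^ (3 * n) * T" for n
  proof (induction n)
    case (Suc n)
    have "T * W ^ Suc n = W ^ (3 * n) * (T * W)"
      by (simp only: power_Suc2 mult.assoc [symmetric] Suc.IH)
    also have "\<dots> = W ^ (3 * n + 3) * T"
      by (simp only: TW mult.assoc [symmetric] power_add)
    also have "3 * n + 3 = 3 * Suc n"
      by simp
    finally show ?case .
  qed simp
  have 1: "W ^ m * (T * W ^ n) = W ^ (m + 3 * n) * T" for m n
    by (simp add: comm power_add mult.assoc)
  have 2: "W ^ m * (T * (W ^ n * T)) = W ^ (m + 3 * n)" for m n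
  proof -
    have "W ^ m * (T * (W ^ n * T)) = (W ^ m * (T * W ^ n)) * T"
      by (simp only: mult.assoc)
    also have "\<dots> = W ^ (m + 3 * n)"
      unfolding 1 by (simp only: mult.assoc T mult_1_right)
    finally show ?thesis .
  qed
  have add: "W ^ expo (i + j) = W ^ expo i * W ^ expo j" for i j
    unfolding expo_add pow_mod_4[OF W] by (rule power_add)
  have diff: "W ^ expo (i - j) = W ^ (expo i + 3 * expo j)" for i j
    unfolding expo_diff pow_mod_4[OF W] by (rule refl)
  show ?thesis
    by (cases x; cases y)
      (simp_all only: plus_d8.simps eval_d8.simps add diff mult.assoc 1 2)
qed

lemma anti_eval_d8_add:
  fixes T W :: "'a::monoid_mult"
  assumes T: "T * T = 1" and W: "W ^ 4 = 1" and WT: "W * T = T * W ^ 3"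
  shows "anti_eval_d8 T W (x + y) = anti_eval_d8 T W y * anti_eval_d8 T W x"
proof -
  have comm: "W ^ n * T = T * W ^ (3 * n)" for n
  proof (induction n)
    case (Suc n)
    have "W ^ Suc n * T = W * T * W ^ (3 * n)"
      by (simp only: power_Suc mult.assoc Suc.IH)
    also have "\<dots> = T * W ^ (3 + 3 * n)"
      by (simp only: WT mult.assoc power_add)
    also have "3 + 3 * n = 3 * Suc n"
      by simp
    finally show ?case .
  qed simp
  have 1: "(W ^ m * T) * W ^ n = T * W ^ (n + 3 * m)" for m n
    by (simp only: comm mult.assoc add.commute[of n] power_add)
  have 2: "T * W ^ m * T * W ^ n = W ^ (n + 3 * m)" for m n
  proof -
    have "T * W ^ m * T * W ^ n = T * ((W ^ m * T) * W ^ n)"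
      by (simp only: mult.assoc)
    also have "\<dots> = W ^ (n + 3 * m)"
      unfolding 1 by (simp only: mult.assoc [symmetric] T mult_1_left)
    finally show ?thesis .
  qed
  have add: "W ^ expo (i + j) = W ^ expo j * W ^ expo i" for i j
    unfolding expo_add pow_mod_4[OF W] add.commute[of "expo i"] by (rule power_add)
  have diff: "W ^ expo (i - j) = W ^ (expo i + 3 * expo j)" for i j
    unfolding expo_diff pow_mod_4[OF W] by (rule refl)
  show ?thesis
    by (cases x; cases y)
      (simp_all only: plus_d8.simps anti_eval_d8.simps add diff mult.assoc [symmetric] 1 2)
qed

lemma lin_ext_single:
  assumes "unit_map \<eta>"
  shows "lin_ext \<eta> \<phi> (Poly_Mapping.single x a) = \<eta> a * \<phi> x"
proof -
  have "\<eta> (0 + 0) = \<eta> 0 + \<eta> 0"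
    using assms unfolding unit_map_def by blast
  then have [simp]: "\<eta> 0 = 0"
    by simp
  have "lin_ext \<eta> \<phi> (Poly_Mapping.single x a) = (\<Sum>y\<in>UNIV. if x = y then \<eta> a * \<phi> x else 0)"
    unfolding lin_ext_def by (intro sum.cong) (auto simp: lookup_single when_def)
  then show ?thesis
    by simp
qed

lemma lin_ext_add:
  assumes "unit_map \<eta>"
  shows "lin_ext \<eta> \<phi> (p + q) = lin_ext \<eta> \<phi> p + lin_ext \<eta> \<phi> q"
proof -
  have *: "\<eta> (a + b) = \<eta> a + \<eta> b" for a b
    using assms unfolding unit_map_def by blast
  show ?thesis
    by (simp only: lin_ext_def lookup_add * distrib_right sum.distrib)
qed

lemma lin_ext_scale:
  assumes "unit_map \<eta>"
  shows "lin_ext \<eta> \<phi> (scale c p) = \<eta> c * lin_ext \<eta> \<phi> p"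
proof -
  have *: "\<eta> (a * b) = \<eta> a * \<eta> b" for a b
    using assms unfolding unit_map_def by blast
  show ?thesis
    by (simp only: lin_ext_def lookup_scale * sum_distrib_left mult.assoc)
qed

lemma lin_ext_sum:
  assumes "unit_map \<eta>" "finite A"
  shows "lin_ext \<eta> \<phi> (sum f A) = (\<Sum>x\<in>A. lin_ext \<eta> \<phi> (f x))"
  using assms(2)
proof induction
  case empty
  have "lin_ext \<eta> \<phi> (0 + 0) = lin_ext \<eta> \<phi> 0 + lin_ext \<eta> \<phi> 0"
    using assms(1) by (rule lin_ext_add)
  then show ?case by simp
qed (simp add: lin_ext_add[OF assms(1)])

lemma poly_mapping_mult_sum:
  "p * q = (\<Sum>x\<in>UNIV. \<Sum>y\<in>UNIV.
     Poly_Mapping.single (x + y) (Poly_Mapping.lookup p x * Poly_Mapping.lookup q y))"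
  for p q :: "'g::{finite, monoid_add} \<Rightarrow>\<^sub>0 'k::semiring_0"
proof -
  have "p * q = (\<Sum>x\<in>UNIV. Poly_Mapping.single x (Poly_Mapping.lookup p x)) *
      (\<Sum>y\<in>UNIV. Poly_Mapping.single y (Poly_Mapping.lookup q y))"
    by (simp only: poly_mapping_sum_singles [symmetric])
  also have "\<dots> = (\<Sum>x\<in>UNIV. \<Sum>y\<in>UNIV.
     Poly_Mapping.single (x + y) (Poly_Mapping.lookup p x * Poly_Mapping.lookup q y))"
    by (simp only: sum_product mult_single)
  finally show ?thesis .
qed

lemma lin_ext_mult:
  assumes \<eta>: "unit_map \<eta>" and \<phi>: "\<And>x y. \<phi> (x + y) = \<phi> x * \<phi> y"
  shows "lin_ext \<eta> \<phi> (p * q) = lin_ext \<eta> \<phi> p * lin_ext \<eta> \<phi> q"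
proof -
  have *: "\<eta> (a * b) * (\<phi> x * \<phi> y) = (\<eta> a * \<phi> x) * (\<eta> b * \<phi> y)" for a b x y
  proof -
    have "\<phi> x * \<eta> b = \<eta> b * \<phi> x" and "\<eta> (a * b) = \<eta> a * \<eta> b"
      using \<eta> unfolding unit_map_def by (metis, blast)
    then show ?thesis
      by (metis mult.assoc)
  qed
  show ?thesis
    unfolding poly_mapping_mult_sum[of p q]
    by (simp only: lin_ext_sum[OF \<eta>] finite lin_ext_single[OF \<eta>] \<phi> *)
      (simp only: lin_ext_def sum_product)
qed

lemma lin_ext_anti_mult:
  assumes \<eta>: "unit_map \<eta>" and \<phi>: "\<And>x y. \<phi> (x + y) = \<phi> y * \<phi> x"
  shows "lin_ext \<eta> \<phi> (p * q) = lin_ext \<eta> \<phi> q * lin_ext \<eta> \<phi> p"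
proof -
  have *: "\<eta> (a * b) * (\<phi> y * \<phi> x) = (\<eta> b * \<phi> y) * (\<eta> a * \<phi> x)" for a b x y
  proof -
    have "\<phi> y * \<eta> a = \<eta> a * \<phi> y" and "\<eta> (a * b) = \<eta> b * \<eta> a"
      using \<eta> unfolding unit_map_def by metis+
    then show ?thesis
      by (metis mult.assoc)
  qed
  show ?thesis
    unfolding poly_mapping_mult_sum[of p q]
    by (simp only: lin_ext_sum[OF \<eta>] finite lin_ext_single[OF \<eta>] \<phi> *)
      (simp only: lin_ext_def sum_product, rule sum.swap)
qed

section \<open>The Kac--Paljutkin algebra\<close>

type_synonym 'k H8 = "d8 \<Rightarrow>\<^sub>0 'k"

definition gen_t :: "'k::field H8" where "gen_t = Poly_Mapping.single (Refl 0) 1"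
definition gen_w :: "'k::field H8" where "gen_w = Poly_Mapping.single (Rot 1) 1"
definition gen_w_inv :: "'k::field H8" where "gen_w_inv = Poly_Mapping.single (- Rot 1) 1"

definition e0 :: "'k::field H8" where "e0 = scale (1/2) (1 + gen_w^2)"
definition e1 :: "'k::field H8" where "e1 = scale (1/2) (1 - gen_w^2)"

definition comult :: "'k::field H8 \<Rightarrow> (d8 \<times> d8 \<Rightarrow>\<^sub>0 'k)" where
  "comult = alg_ext (Poly_Mapping.single 0)
     ((gen_w_inv * gen_t) \<otimes>\<^sub>k (e1 * gen_t) + gen_t \<otimes>\<^sub>k (e0 * gen_t))
     (gen_w \<otimes>\<^sub>k (e0 * gen_w) + gen_w_inv \<otimes>\<^sub>k (e1 * gen_w))"

definition counit :: "'k::field H8 \<Rightarrow> 'k" where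
  "counit = alg_ext id 1 1"

definition antipode :: "'k::field H8 \<Rightarrow> 'k H8" where
  "antipode = anti_ext (Poly_Mapping.single 0) ((e0 - e1 * gen_w) * gen_t) gen_w"

text \<open>
  The proved facts below show that the structure maps are the (anti-)homomorphisms with the
  prescribed values on the generators, and that they are determined by this.
\<close>

lemma lin_ext_one:
  assumes "unit_map \<eta>" "\<phi> 0 = 1"
  shows "lin_ext \<eta> \<phi> 1 = 1"
proof -
  have "lin_ext \<eta> \<phi> (Poly_Mapping.single 0 1) = \<eta> 1 * \<phi> 0"
    using assms(1) by (rule lin_ext_single)
  moreover have "\<eta> 1 = 1"
    using assms(1) unfolding unit_map_def by blast
  ultimately show ?thesis
    by (simp add: assms(2))
qed

lemma lin_ext_basis:
  assumes "unit_map \<eta>"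
  shows "lin_ext \<eta> \<phi> (Poly_Mapping.single x 1) = \<phi> x"
proof -
  have "\<eta> 1 = 1"
    using assms unfolding unit_map_def by blast
  then show ?thesis
    by (simp add: lin_ext_single[OF assms])
qed

theorem alg_ext_hom:
  assumes "unit_map \<eta>" and "T * T = 1" "W ^ 4 = 1" "T * W = W ^ 3 * T"
  shows "alg_ext \<eta> T W 1 = 1"
    and "alg_ext \<eta> T W (p + q) = alg_ext \<eta> T W p + alg_ext \<eta> T W q"
    and "alg_ext \<eta> T W (scale c p) = \<eta> c * alg_ext \<eta> T W p"
    and "alg_ext \<eta> T W (p * q) = alg_ext \<eta> T W p * alg_ext \<eta> T W q"
    and "alg_ext \<eta> T W gen_t = T"
    and "alg_ext \<eta> T W gen_w = W"
proof -
  have 0: "eval_d8 T W 0 = 1"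
    by (simp add: zero_d8_def bit0.Rep_0)
  show "alg_ext \<eta> T W 1 = 1"
    unfolding alg_ext_def using assms(1) 0 by (rule lin_ext_one)
  show "alg_ext \<eta> T W (p + q) = alg_ext \<eta> T W p + alg_ext \<eta> T W q"
    unfolding alg_ext_def using assms(1) by (rule lin_ext_add)
  show "alg_ext \<eta> T W (scale c p) = \<eta> c * alg_ext \<eta> T W p"
    unfolding alg_ext_def using assms(1) by (rule lin_ext_scale)
  show "alg_ext \<eta> T W (p * q) = alg_ext \<eta> T W p * alg_ext \<eta> T W q"
    unfolding alg_ext_def using assms(1) eval_d8_add[OF assms(2-4)] by (rule lin_ext_mult)
  show "alg_ext \<eta> T W gen_t = T"
    unfolding alg_ext_def gen_t_def lin_ext_basis[OF assms(1)] by (simp add: bit0.Rep_0)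
  show "alg_ext \<eta> T W gen_w = W"
    unfolding alg_ext_def gen_w_def lin_ext_basis[OF assms(1)] by (simp add: bit0.Rep_1)
qed

theorem anti_ext_hom:
  assumes "unit_map \<eta>" and "T * T = 1" "W ^ 4 = 1" "W * T = T * W ^ 3"
  shows "anti_ext \<eta> T W 1 = 1"
    and "anti_ext \<eta> T W (p + q) = anti_ext \<eta> T W p + anti_ext \<eta> T W q"
    and "anti_ext \<eta> T W (scale c p) = \<eta> c * anti_ext \<eta> T W p"
    and "anti_ext \<eta> T W (p * q) = anti_ext \<eta> T W q * anti_ext \<eta> T W p"
    and "anti_ext \<eta> T W gen_t = T"
    and "anti_ext \<eta> T W gen_w = W"
proof -
  have 0: "anti_eval_d8 T W 0 = 1"
    by (simp add: zero_d8_def bit0.Rep_0)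
  show "anti_ext \<eta> T W 1 = 1"
    unfolding anti_ext_def using assms(1) 0 by (rule lin_ext_one)
  show "anti_ext \<eta> T W (p + q) = anti_ext \<eta> T W p + anti_ext \<eta> T W q"
    unfolding anti_ext_def using assms(1) by (rule lin_ext_add)
  show "anti_ext \<eta> T W (scale c p) = \<eta> c * anti_ext \<eta> T W p"
    unfolding anti_ext_def using assms(1) by (rule lin_ext_scale)
  show "anti_ext \<eta> T W (p * q) = anti_ext \<eta> T W q * anti_ext \<eta> T W p"
    unfolding anti_ext_def using assms(1) anti_eval_d8_add[OF assms(2-4)] by (rule lin_ext_anti_mult)
  show "anti_ext \<eta> T W gen_t = T"
    unfolding anti_ext_def gen_t_def lin_ext_basis[OF assms(1)] by (simp add: bit0.Rep_0)
  show "anti_ext \<eta> T W gen_w = W"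
    unfolding anti_ext_def gen_w_def lin_ext_basis[OF assms(1)] by (simp add: bit0.Rep_1)
qed

lemma gen_w_power: "gen_w ^ n = Poly_Mapping.single (Rot (of_nat n)) 1"
  by (induction n) (simp_all add: gen_w_def mult_single flip: zero_d8_def)

lemma of_nat_expo: "of_nat (expo i) = i"
proof -
  have "i \<in> {0, 1, 2, 3}"
    by (simp only: UNIV_4 [symmetric] UNIV_I)
  then show ?thesis
    by (auto simp: bit0.Rep_0 bit0.Rep_1 bit0.Rep_numeral)
qed

lemma single_Rot: "Poly_Mapping.single (Rot i) 1 = gen_w ^ expo i"
  by (simp only: gen_w_power of_nat_expo)

lemma single_Refl: "Poly_Mapping.single (Refl i) 1 = gen_w ^ expo i * gen_t"
  by (simp only: gen_w_power of_nat_expo gen_t_def mult_single) simp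

theorem alg_ext_unique:
  assumes \<eta>: "unit_map \<eta>"
    and one: "h 1 = 1"
    and add: "\<And>p q. h (p + q) = h p + h q"
    and scale: "\<And>c p. h (scale c p) = \<eta> c * h p"
    and mult: "\<And>p q. h (p * q) = h p * h q"
    and "h gen_t = T" "h gen_w = W"
  shows "h = alg_ext \<eta> T W"
proof
  fix p :: "'a H8"
  have power: "h (q ^ n) = h q ^ n" for q n
    by (induction n) (simp_all add: one mult)
  have basis: "h (Poly_Mapping.single x 1) = eval_d8 T W x" for x
    by (cases x) (simp_all add: single_Rot single_Refl power mult assms(6,7))
  have single: "Poly_Mapping.single x c = scale c (Poly_Mapping.single x (1::'a))" for c and x :: d8
    by (rule poly_mapping_eqI) (simp add: lookup_single when_def)
  have "h (0 + 0) = h 0 + h 0"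
    by (rule add)
  then have zero: "h 0 = 0"
    by simp
  have sum: "h (sum f A) = (\<Sum>x\<in>A. h (f x))" if "finite A" for f and A :: "d8 set"
    using that by induction (simp_all add: zero add)
  have "h p = h (\<Sum>x\<in>UNIV. Poly_Mapping.single x (Poly_Mapping.lookup p x))"
    by (simp only: poly_mapping_sum_singles [symmetric])
  also have "\<dots> = (\<Sum>x\<in>UNIV. h (scale (Poly_Mapping.lookup p x) (Poly_Mapping.single x 1)))"
    by (simp only: sum[OF finite] single[symmetric])
  also have "\<dots> = alg_ext \<eta> T W p"
    by (simp only: scale basis alg_ext_def lin_ext_def)
  finally show "h p = alg_ext \<eta> T W p" .
qed

lemma numerals_4: "(4::4) = 0" "(- 1::4) = 3" "(- 2::4) = 2"
proof -
  show *: "(4::4) = 0"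
    by (simp add: bit0.Rep_0 bit0.Rep_numeral flip: Rep_bit0_inject)
  have "(3::4) + 1 = 4"
    by simp
  then show "(- 1::4) = 3"
    unfolding * by (metis add_diff_cancel_left' add.commute diff_0)
  have "(2::4) + 2 = 4"
    by simp
  then show "(- 2::4) = 2"
    unfolding * by (rule minus_unique)
qed

lemma gen_rels:
  "gen_t * gen_t = 1" "gen_w ^ 4 = 1" "gen_t * gen_w = gen_w_inv * gen_t"
  "gen_w * gen_w_inv = 1" "gen_w_inv * gen_w = 1"
  "gen_w_inv = gen_w ^ 3"
  unfolding gen_w_power unfolding gen_t_def gen_w_def gen_w_inv_def
  by (simp_all add: mult_single zero_d8_def numerals_4 flip: single_one)

text \<open>
  Rewriting to the normal form \<open>e\<^sub>i w\<^sup>i t\<^sup>j\<close>, with the central element \<open>z = w\<^sup>2\<close>.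
\<close>

definition gen_z :: "'k::field H8" where "gen_z = gen_w^2"

lemma gen_w_inv_eq: "gen_w_inv = gen_z * gen_w"
  by (simp add: gen_rels(6) gen_z_def power2_eq_square power3_eq_cube mult.assoc)

lemma e_eq:
  "e0 = Poly_Mapping.single (Rot 0) (1/2) + Poly_Mapping.single (Rot 2) (1/2)"
  "e1 = Poly_Mapping.single (Rot 0) (1/2) - Poly_Mapping.single (Rot 2) (1/2)"
  unfolding e0_def e1_def scale_eq_mult gen_w_power
  by (simp_all add: algebra_simps mult_single zero_d8_def single_one[symmetric] del: single_one)

lemma normal_form:
  "gen_w * gen_w = gen_z" "gen_t * gen_t = 1" "gen_t * gen_w = gen_z * (gen_w * gen_t)"
  "gen_w * gen_z = gen_z * gen_w" "gen_t * gen_z = gen_z * gen_t" "gen_z * gen_z = 1"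
  unfolding gen_z_def gen_w_power unfolding gen_w_def gen_t_def
  by (simp_all add: mult_single zero_d8_def numerals_4 flip: single_one)

lemma normal_form_e:
  "gen_w * e0 = e0 * gen_w" "gen_w * e1 = e1 * gen_w"
  "gen_t * e0 = e0 * gen_t" "gen_t * e1 = e1 * gen_t"
  "gen_z * e0 = e0" "gen_z * e1 = - e1" "e0 * gen_z = e0" "e1 * gen_z = - e1"
  unfolding e_eq gen_z_def gen_w_power unfolding gen_w_def gen_t_def
  by (simp_all add: mult_single numerals_4 algebra_simps)

lemma e_idem:
  assumes "(2::'k::field) \<noteq> 0"
  shows "e0 * e0 = (e0 :: 'k H8)" "e1 * e1 = (e1 :: 'k H8)"
    "e0 * e1 = (0 :: 'k H8)" "e1 * e0 = (0 :: 'k H8)" "e0 + e1 = (1 :: 'k H8)"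
proof -
  have 1: "1/4 + 1/4 = (1/2 :: 'k)"
  proof -
    have "(2::'k) * 2 \<noteq> 0"
      using assms by (simp only: mult_eq_0_iff simp_thms)
    then show ?thesis
      using assms by (simp add: field_simps)
  qed
  have 2: "1/2 + 1/2 = (1 :: 'k)"
    using assms by (simp add: field_simps)
  show "e0 * e0 = (e0 :: 'k H8)" "e1 * e1 = (e1 :: 'k H8)"
    "e0 * e1 = (0 :: 'k H8)" "e1 * e0 = (0 :: 'k H8)"
    unfolding e_eq
    by (rule poly_mapping_eqI;
        simp add: mult_single algebra_simps numerals_4 lookup_add lookup_minus lookup_single when_def
          1 flip: 1)+
  show "e0 + e1 = (1 :: 'k H8)"
    unfolding e_eq by (simp add: 2 zero_d8_def flip: single_add single_one)
qed

definition hopf_aut :: "('k::field H8 \<Rightarrow> 'k H8) \<Rightarrow> bool" where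
  "hopf_aut f \<longleftrightarrow>
     bij f \<and> Vector_Spaces.linear scale scale f \<and>
     f 1 = 1 \<and> (\<forall>p q. f (p * q) = f p * f q) \<and>
     (\<forall>p. comult (f p) = tensor_map f f (comult p)) \<and>
     (\<forall>p. counit (f p) = counit p) \<and>
     (\<forall>p. antipode (f p) = f (antipode p))"

definition Aut_H8 :: "('k::field H8 \<Rightarrow> 'k H8) monoid" where
  "Aut_H8 = \<lparr>carrier = {f. hopf_aut f}, monoid.mult = (\<circ>), one = id\<rparr>"

definition f_plus :: "'k::field H8 \<Rightarrow> 'k H8" where
  "f_plus = alg_ext (Poly_Mapping.single 0) (gen_w * gen_t) gen_w_inv"

definition f_minus :: "'k::field H8 \<Rightarrow> 'k H8" where
  "f_minus = alg_ext (Poly_Mapping.single 0) (gen_w_inv * gen_t) gen_w_inv"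

definition f_plus_minus :: "'k::field H8 \<Rightarrow> 'k H8" where
  "f_plus_minus = f_plus \<circ> f_minus"


lemma left_assoc: "a * b = c \<Longrightarrow> a * (b * x) = c * x" for a b c x :: "'a::semigroup_mult"
  by (simp add: mult.assoc [symmetric])

lemmas normal_form_rules = mult.assoc distrib_left distrib_right
  left_diff_distrib right_diff_distrib
  gen_w_inv_eq normal_form normal_form_e
  normal_form [THEN left_assoc] normal_form_e [THEN left_assoc]

lemma four: "(x::'a::monoid_mult) ^ 4 = x * (x * (x * x))" and three: "x ^ 3 = x * (x * x)"
  by (simp_all add: numeral_eq_Suc)

theorem comult_hom:
  assumes 2: "(2::'k::field) \<noteq> 0"
  shows "comult (1 :: 'k H8) = 1"
    and "comult (p + q) = comult p + comult (q :: 'k H8)"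
    and "comult (scale c p) = scale c (comult (p :: 'k H8))"
    and "comult (p * q) = comult p * comult (q :: 'k H8)"
    and "comult (gen_t :: 'k H8) = (gen_w_inv * gen_t) \<otimes>\<^sub>k (e1 * gen_t) + gen_t \<otimes>\<^sub>k (e0 * gen_t)"
    and "comult (gen_w :: 'k H8) = gen_w \<otimes>\<^sub>k (e0 * gen_w) + gen_w_inv \<otimes>\<^sub>k (e1 * gen_w)"
proof -
  let ?T = "(gen_w_inv * gen_t) \<otimes>\<^sub>k (e1 * gen_t) + gen_t \<otimes>\<^sub>k (e0 * gen_t) :: d8 \<times> d8 \<Rightarrow>\<^sub>0 'k"
  let ?W = "gen_w \<otimes>\<^sub>k (e0 * gen_w) + gen_w_inv \<otimes>\<^sub>k (e1 * gen_w) :: d8 \<times> d8 \<Rightarrow>\<^sub>0 'k"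
  note rules = normal_form_rules e_idem[OF 2] e_idem(1-4)[OF 2, THEN left_assoc] tensor_mult_tensor
    tensor_add_left tensor_add_right tensor_minus_left tensor_minus_right
    tensor_zero_left tensor_zero_right
  have one: "1 \<otimes>\<^sub>k e0 + 1 \<otimes>\<^sub>k e1 = (1 :: d8 \<times> d8 \<Rightarrow>\<^sub>0 'k)"
    by (simp only: tensor_add_right [symmetric] e_idem(5)[OF 2] tensor_one)
  have T: "?T * ?T = 1" and W: "?W ^ 4 = 1" and TW: "?T * ?W = ?W ^ 3 * ?T"
    using one by (simp_all add: four three rules add.commute)
  note * = alg_ext_hom[OF unit_map_single T W TW, folded comult_def]
  show "comult (1 :: 'k H8) = 1"
    and "comult (p + q) = comult p + comult (q :: 'k H8)"
    and "comult (scale c p) = scale c (comult (p :: 'k H8))"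
    and "comult (p * q) = comult p * comult (q :: 'k H8)"
    and "comult (gen_t :: 'k H8) = ?T"
    and "comult (gen_w :: 'k H8) = ?W"
    by (simp_all only: * scale_eq_mult[of _ "comult p"])
qed

theorem counit_hom:
  "counit 1 = 1" "counit (p + q) = counit p + counit q" "counit (scale c p) = c * counit p"
  "counit (p * q) = counit p * counit q" "counit gen_t = 1" "counit gen_w = 1"
  unfolding counit_def by (simp_all add: alg_ext_hom[OF unit_map_id])

theorem antipode_anti_hom:
  assumes 2: "(2::'k::field) \<noteq> 0"
  shows "antipode (1 :: 'k H8) = 1"
    and "antipode (p + q) = antipode p + antipode (q :: 'k H8)"
    and "antipode (scale c p) = scale c (antipode (p :: 'k H8))"
    and "antipode (p * q) = antipode q * antipode (p :: 'k H8)"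
    and "antipode (gen_t :: 'k H8) = (e0 - e1 * gen_w) * gen_t"
    and "antipode (gen_w :: 'k H8) = gen_w"
proof -
  let ?T = "(e0 - e1 * gen_w) * gen_t :: 'k H8"
  note rules = normal_form_rules e_idem[OF 2] e_idem(1-4)[OF 2, THEN left_assoc]
  have T: "?T * ?T = 1" and WT: "gen_w * ?T = ?T * gen_w ^ 3" and W: "gen_w ^ 4 = (1 :: 'k H8)"
    by (simp_all add: four three rules)
  note * = anti_ext_hom[OF unit_map_single T W WT, folded antipode_def]
  show "antipode (1 :: 'k H8) = 1"
    and "antipode (p + q) = antipode p + antipode (q :: 'k H8)"
    and "antipode (scale c p) = scale c (antipode (p :: 'k H8))"
    and "antipode (p * q) = antipode q * antipode (p :: 'k H8)"
    and "antipode (gen_t :: 'k H8) = ?T"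
    and "antipode (gen_w :: 'k H8) = gen_w"
    by (simp_all only: * scale_eq_mult[of _ "antipode p"])
qed

theorem f_plus_hom:
  fixes p q :: "'k::field H8"
  shows "f_plus (1 :: 'k H8) = 1"
    and "f_plus (p + q) = f_plus p + f_plus q"
    and "f_plus (scale c p) = scale c (f_plus p)"
    and "f_plus (p * q) = f_plus p * f_plus q"
    and "f_plus (gen_t :: 'k H8) = gen_w * gen_t"
    and "f_plus (gen_w :: 'k H8) = gen_w_inv"
proof -
  have rels: "(gen_w * gen_t) * (gen_w * gen_t) = (1 :: 'k H8)" "gen_w_inv ^ 4 = (1 :: 'k H8)"
    "(gen_w * gen_t) * gen_w_inv = gen_w_inv ^ 3 * (gen_w * gen_t :: 'k H8)"
    by (simp_all add: four three normal_form_rules)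
  note * = alg_ext_hom[OF unit_map_single rels, folded f_plus_def]
  show "f_plus (1 :: 'k H8) = 1"
    and "f_plus (p + q) = f_plus p + f_plus q"
    and "f_plus (scale c p) = scale c (f_plus p)"
    and "f_plus (p * q) = f_plus p * f_plus q"
    and "f_plus (gen_t :: 'k H8) = gen_w * gen_t"
    and "f_plus (gen_w :: 'k H8) = gen_w_inv"
    by (simp_all only: * scale_eq_mult[of _ "f_plus p"])
qed

theorem f_minus_hom:
  fixes p q :: "'k::field H8"
  shows "f_minus (1 :: 'k H8) = 1"
    and "f_minus (p + q) = f_minus p + f_minus q"
    and "f_minus (scale c p) = scale c (f_minus p)"
    and "f_minus (p * q) = f_minus p * f_minus q"
    and "f_minus (gen_t :: 'k H8) = gen_w_inv * gen_t"
    and "f_minus (gen_w :: 'k H8) = gen_w_inv"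
proof -
  have rels: "(gen_w_inv * gen_t) * (gen_w_inv * gen_t) = (1 :: 'k H8)" "gen_w_inv ^ 4 = (1 :: 'k H8)"
    "(gen_w_inv * gen_t) * gen_w_inv = gen_w_inv ^ 3 * (gen_w_inv * gen_t :: 'k H8)"
    by (simp_all add: four three normal_form_rules)
  note * = alg_ext_hom[OF unit_map_single rels, folded f_minus_def]
  show "f_minus (1 :: 'k H8) = 1"
    and "f_minus (p + q) = f_minus p + f_minus q"
    and "f_minus (scale c p) = scale c (f_minus p)"
    and "f_minus (p * q) = f_minus p * f_minus q"
    and "f_minus (gen_t :: 'k H8) = gen_w_inv * gen_t"
    and "f_minus (gen_w :: 'k H8) = gen_w_inv"
    by (simp_all only: * scale_eq_mult[of _ "f_minus p"])
qed

end

theory Submission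
  imports Defs
begin

text \<open>
  Put \<open>z = w\<^sup>2\<close>. The coproducts of \<open>t\<close> and \<open>w\<close> become those of the group algebra once the
  right-hand tensor factor is multiplied by the central idempotent \<open>e\<^sub>0 = (1 + z)/2\<close>:
  \<open>(1 \<otimes> e\<^sub>0) \<Delta>(g) = g \<otimes> e\<^sub>0 g\<close> for every \<open>g\<close> in the dihedral group. Since
  \<open>e\<^sub>0 kD\<^sub>8\<close> is the group algebra of \<open>D\<^sub>8/\<langle>z\<rangle>\<close>, this says that the coproduct induces on \<open>kD\<^sub>8\<close> the
  obvious grading by \<open>D\<^sub>8/\<langle>z\<rangle>\<close>. A nonzero \<open>p\<close> with \<open>(1 \<otimes> e\<^sub>0) \<Delta>(p) = p \<otimes> e\<^sub>0 p\<close> is therefore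
  homogeneous, and comparing coefficients forces \<open>p = (e\<^sub>0 + c e\<^sub>1) x\<close> with a scalar \<open>c\<close> and
  \<open>x \<in> {1, w, t, wt}\<close> (lemma \<open>grouplike_mod_e1_cases\<close>).

  Let \<open>f\<close> be a Hopf automorphism. The element \<open>z\<close> is group-like, central and of order \<open>2\<close>,
  and so is \<open>f(z)\<close>, hence \<open>f(z) = z\<close> by the normal form. So \<open>f\<close> fixes \<open>e\<^sub>0\<close> and \<open>e\<^sub>1\<close>, and the
  normal form applies to \<open>f(w)\<close> and \<open>f(t)\<close> as well. It leaves one scalar and one of four group
  elements for each of them. The scalars are \<open>\<plusminus>1\<close> because \<open>w\<^sup>2 = z\<close> and \<open>t\<^sup>2 = 1\<close>. As \<open>f(w)\<close> and
  \<open>f(t)\<close> do not commute, \<open>x = 1\<close> is impossible for \<open>f(w)\<close>, and then \<open>x = 1\<close> and \<open>x = w\<close> are impossible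
  for \<open>f(t)\<close>. The rest is done by the antipode: \<open>S(w) = w\<close> excludes \<open>t\<close> and \<open>wt\<close> for \<open>f(w)\<close>, and
  \<open>S(f(t)) = f(S(t))\<close> ties the choice of \<open>f(w)\<close> to that of \<open>f(t)\<close> (lemma \<open>f_gens\<close>). Exactly the
  values of the identity, \<open>f\<^sub>+\<close>, \<open>f\<^sub>-\<close> and \<open>f\<^sub>+ \<circ> f\<^sub>-\<close> on the generators remain.

  Conversely, compatibility with the Hopf structure may be checked on \<open>t\<close> and \<open>w\<close>
  (lemma \<open>hopf_autI\<close>), and \<open>f\<^sub>+\<close> and \<open>f\<^sub>-\<close> are two distinct commuting involutions other than the
  identity, so they generate a Klein four-group.
\<close>

section \<open>Linear algebra in the group algebra\<close>

lemma scale_mult_left: "scale c p * q = scale c (p * q)"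
  for p q :: "'g::monoid_add \<Rightarrow>\<^sub>0 'k::semiring_0"
  by (simp only: scale_eq_mult mult.assoc)

lemma scale_mult_right: "p * scale c q = scale c (p * q)"
  for p q :: "'g::{finite, monoid_add} \<Rightarrow>\<^sub>0 'k::field"
  unfolding scale_eq_mult by (metis mult.assoc single_0_central)

lemma scale_one [simp]: "scale 1 p = p"
  for p :: "'g \<Rightarrow>\<^sub>0 'k::semiring_1"
  by (rule poly_mapping_eqI) simp

lemma scale_zero [simp]: "scale 0 p = 0" "scale c 0 = 0"
  for p :: "'g \<Rightarrow>\<^sub>0 'k::semiring_0"
  by (rule poly_mapping_eqI; simp)+

lemma scale_scale [simp]: "scale a (scale b p) = scale (a * b) p"
  for p :: "'g \<Rightarrow>\<^sub>0 'k::semiring_0"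
  by (rule poly_mapping_eqI) (simp add: mult.assoc)

lemma scale_minus: "scale (- c) p = - scale c p" "scale c (- p) = - scale c p"
  for p :: "'g \<Rightarrow>\<^sub>0 'k::ring"
  by (rule poly_mapping_eqI; simp)+

lemma scale_diff_left: "scale (a - b) p = scale a p - scale b p"
  for p :: "'g \<Rightarrow>\<^sub>0 'k::ring"
  by (rule poly_mapping_eqI) (simp add: lookup_minus left_diff_distrib)

lemma scale_cancel_left: "scale c p = scale c q \<longleftrightarrow> c = 0 \<or> p = q"
  for p q :: "'g \<Rightarrow>\<^sub>0 'k::field"
  using vector_space.scale_cancel_left[OF vector_space_scale] by metis

lemma scale_cancel_right: "scale a p = scale b p \<longleftrightarrow> a = b \<or> p = 0"
  for p :: "'g \<Rightarrow>\<^sub>0 'k::field"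
  by (rule vector_space.scale_cancel_right[OF vector_space_scale])

lemma single_eq_scale: "Poly_Mapping.single x c = scale c (Poly_Mapping.single x 1)"
  for c :: "'k::semiring_1"
  by (rule poly_mapping_eqI) (simp add: lookup_single when_def)

text \<open>
  Identities between linear (anti-)multiplicative maps need to be checked on \<open>t\<close> and \<open>w\<close> only;
  this rule is how all such reductions to generators are made below.
\<close>

lemma H8_induct [case_names one t w add scale mult]:
  assumes "P 1" and t: "P gen_t" and w: "P gen_w"
    and add: "\<And>p q. P p \<Longrightarrow> P q \<Longrightarrow> P (p + q)"
    and scale: "\<And>c p. P p \<Longrightarrow> P (scale c p)"
    and mult: "\<And>p q. P p \<Longrightarrow> P q \<Longrightarrow> P (p * q)"
  shows "P (p :: 'k::field H8)"
proof -
  have power: "P (gen_w ^ n)" for n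
    by (induction n) (simp_all add: assms(1) w mult)
  have basis: "P (Poly_Mapping.single x 1)" for x
    by (cases x) (simp_all only: single_Rot single_Refl power t mult)
  have zero: "P 0"
    using scale[OF assms(1), of 0] by simp
  have sum: "P (sum f A)" if "finite A" "\<And>x. P (f x)" for f and A :: "d8 set"
    using that by induction (simp_all add: zero add)
  show ?thesis
    by (subst poly_mapping_sum_singles, subst single_eq_scale)
      (intro sum finite scale basis)
qed

lemma e_central: "e0 * p = p * e0" "e1 * p = p * e1"
proof -
  show "e0 * p = p * e0"
  proof (induction p rule: H8_induct)
    case (mult p q)
    then show ?case
      by (metis mult.assoc)
  qed (simp_all add: normal_form_e distrib_left distrib_right scale_mult_left scale_mult_right)
  show "e1 * p = p * e1"
  proof (induction p rule: H8_induct)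
    case (mult p q)
    then show ?case
      by (metis mult.assoc)
  qed (simp_all add: normal_form_e distrib_left distrib_right scale_mult_left scale_mult_right)
qed

section \<open>The two blocks cut out by the central idempotents\<close>

context
  assumes two: "(2::'k::field) \<noteq> 0"
begin

lemma e1_nonzero: "(e1 :: 'k H8) \<noteq> 0"
proof
  assume "(e1 :: 'k H8) = 0"
  then have "Poly_Mapping.lookup (e1 :: 'k H8) (Rot 0) = 0"
    by simp
  then show False
    using two by (simp add: e_eq lookup_minus lookup_single)
qed

text \<open>
  In the block of \<open>e\<^sub>0\<close> the element \<open>z\<close> acts as \<open>1\<close> and all group elements commute; in the block of
  \<open>e\<^sub>1\<close> it acts as \<open>-1\<close> and \<open>t\<close> and \<open>w\<close> anticommute. This lemma and the next, which uses
  that \<open>2\<close> is invertible, turn identities in that block into contradictions.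
\<close>

lemma e1_mult_nonzero:
  fixes p q :: "'k H8"
  assumes "p * q = 1"
  shows "e1 * p \<noteq> 0"
proof
  assume "e1 * p = 0"
  then have "e1 * p * q = 0"
    by simp
  then show False
    using e1_nonzero by (simp add: mult.assoc assms)
qed

lemma e1_neq_minus:
  fixes p q :: "'k H8"
  assumes "p * q = 1"
  shows "e1 * p \<noteq> - (e1 * p)"
proof
  assume *: "e1 * p = - (e1 * p)"
  have "scale 2 (e1 * p) = e1 * p + e1 * p"
    by (rule poly_mapping_eqI) (simp add: lookup_add)
  also have "\<dots> = scale 2 0"
    using * by (metis add.right_inverse scale_zero(2))
  finally show False
    using e1_mult_nonzero[OF assms] two by (simp only: scale_cancel_left) simp
qed

lemma eq_iff_block_eq: "p = q \<longleftrightarrow> e0 * p = e0 * q \<and> e1 * p = e1 * (q :: 'k H8)"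
proof -
  have "r = e0 * r + e1 * r" for r :: "'k H8"
    unfolding distrib_right [symmetric] e_idem(5)[OF two] by simp
  then show ?thesis
    by metis
qed

lemma gen_z_eq: "(gen_z :: 'k H8) = e0 - e1"
  unfolding eq_iff_block_eq[of gen_z] by (simp add: right_diff_distrib normal_form_e e_idem(1-4)[OF two])

lemma comult_gen_z: "comult (gen_z :: 'k H8) = gen_z \<otimes>\<^sub>k gen_z"
proof -
  have "comult (gen_z :: 'k H8) = gen_z \<otimes>\<^sub>k e0 + - (gen_z \<otimes>\<^sub>k e1)"
    unfolding gen_z_def power2_eq_square comult_hom(4,6)[OF two]
    by (simp add: normal_form_rules e_idem(1-4)[OF two] e_idem(1-4)[OF two, THEN left_assoc]
        tensor_mult_tensor tensor_minus_right tensor_zero_right flip: gen_z_def)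
  also have "\<dots> = gen_z \<otimes>\<^sub>k (e0 + - e1)"
    by (simp only: tensor_add_right tensor_minus_right)
  also have "e0 + - e1 = (gen_z :: 'k H8)"
    by (simp add: gen_z_eq)
  finally show ?thesis .
qed

lemma gen_z_central: "gen_z * p = p * (gen_z :: 'k H8)"
  unfolding gen_z_eq left_diff_distrib right_diff_distrib by (simp only: e_central)

lemma gen_z_not_one: "(gen_z :: 'k H8) \<noteq> 1"
proof
  assume "gen_z = (1 :: 'k H8)"
  then have "e1 * gen_z = (e1 * 1 :: 'k H8)"
    by (rule arg_cong)
  then show False
    using e1_neq_minus[of 1 1] by (simp add: normal_form_e)
qed

lemma gens_not_commute: "gen_w * gen_t \<noteq> (gen_t * gen_w :: 'k H8)"
proof
  assume "gen_w * gen_t = (gen_t * gen_w :: 'k H8)"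
  then have "e1 * (gen_w * gen_t) = e1 * (gen_t * gen_w :: 'k H8)"
    by (rule arg_cong)
  moreover have "(gen_w * gen_t) * (gen_w * gen_t) = (1 :: 'k H8)"
    by (simp add: normal_form_rules)
  ultimately show False
    using e1_neq_minus[of "gen_w * gen_t" "gen_w * gen_t"] by (simp add: normal_form_rules)
qed

lemma antipode_e: "antipode (e0 :: 'k H8) = e0" "antipode (e1 :: 'k H8) = e1"
proof -
  have "antipode (gen_w ^ 2 :: 'k H8) = gen_w ^ 2"
    by (simp add: power2_eq_square antipode_anti_hom[OF two])
  then show e0: "antipode (e0 :: 'k H8) = e0"
    by (simp add: e0_def antipode_anti_hom[OF two])
  have "antipode (e0 + e1 :: 'k H8) = 1"
    by (simp only: e_idem(5)[OF two] antipode_anti_hom[OF two])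
  then show "antipode (e1 :: 'k H8) = e1"
    by (metis e0 antipode_anti_hom(2)[OF two] add_left_cancel e_idem(5)[OF two])
qed

lemma antipode_e1_mult: "antipode (e1 * p) = e1 * antipode (p :: 'k H8)"
  by (simp add: antipode_anti_hom[OF two] antipode_e e_central)

text \<open>
  Up to sign, the antipode interchanges \<open>t\<close> and \<open>wt\<close> in the block of \<open>e\<^sub>1\<close>, so it
  tells reflections from the generator \<open>w\<close>, which it fixes.
\<close>

lemma antipode_e1_refl:
  "antipode (e1 * gen_t :: 'k H8) = - (e1 * (gen_w * gen_t))"
  "antipode (e1 * (gen_w * gen_t) :: 'k H8) = - (e1 * gen_t)"
  by (simp_all add: antipode_anti_hom[OF two] antipode_e normal_form_rules e_idem(1-4)[OF two]
      e_idem(1-4)[OF two, THEN left_assoc])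

lemma e1_refl_neq: "e1 * gen_t \<noteq> (- (e1 * (gen_w * gen_t)) :: 'k H8)"
proof
  assume "e1 * gen_t = (- (e1 * (gen_w * gen_t)) :: 'k H8)"
  then have "e1 * gen_t * gen_t = (- (e1 * (gen_w * gen_t)) * gen_t :: 'k H8)"
    by (rule arg_cong)
  then have *: "e1 = - (e1 * gen_w :: 'k H8)"
    by (simp add: normal_form_rules)
  \<comment> \<open>Squaring gives \<open>e\<^sub>1 = e\<^sub>1 z = - e\<^sub>1\<close>.\<close>
  then have "e1 * e1 = (- (e1 * gen_w)) * (- (e1 * gen_w :: 'k H8))"
    by metis
  then show False
    using e1_neq_minus[of 1 1]
    by (simp add: normal_form_rules e_idem(1-4)[OF two] e_idem(1-4)[OF two, THEN left_assoc])
qed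

text \<open>
  Determines the scalar in a normal form \<open>e\<^sub>0 x + c e\<^sub>1 x\<close> up to sign, once the square of the
  element is known.
\<close>

lemma e1_square:
  assumes "e1 * p = scale c (e1 * x)"
  shows "e1 * (p * p) = scale (c * c) (e1 * (x * x :: 'k H8))"
proof -
  have "e1 * (p * p) = (e1 * p) * p"
    by (simp only: mult.assoc)
  also have "\<dots> = scale c (e1 * x) * p"
    by (simp only: assms(1))
  also have "\<dots> = scale c (x * (e1 * p))"
    by (simp only: scale_mult_left e_central(2)[of x] mult.assoc)
  also have "\<dots> = scale (c * c) (x * (e1 * x))"
    unfolding assms(1) by (simp add: scale_mult_right)
  also have "x * (e1 * x) = e1 * (x * x)"
    by (simp add: e_central mult.assoc)
  finally show ?thesis .
qed

end

section \<open>The grading by the central quotient of the dihedral group\<close>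

text \<open>
  The coproduct is compared with \<open>p \<otimes> p\<close> only after the projection of the right-hand
  factor to the quotient by the ideal of \<open>e\<^sub>1\<close>, which multiplication by \<open>e\<^sub>0\<close> realises.
\<close>

definition grouplike_mod_e1 :: "'k::field H8 \<Rightarrow> bool" where
  "grouplike_mod_e1 p \<longleftrightarrow> (1 \<otimes>\<^sub>k e0) * comult p = p \<otimes>\<^sub>k (e0 * p)"

context
  assumes two: "(2::'k::field) \<noteq> 0"
begin

lemma grouplike_mod_e1_one: "grouplike_mod_e1 (1 :: 'k H8)"
  by (simp add: grouplike_mod_e1_def comult_hom[OF two])

text \<open>
  As \<open>e\<^sub>0\<close> is idempotent and commutes with \<open>p\<close>, the factor \<open>1 \<otimes> e\<^sub>0\<close> can be inserted a second time
  between the coproducts of \<open>p\<close> and \<open>q\<close>.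
\<close>

lemma grouplike_mod_e1_mult:
  assumes "grouplike_mod_e1 p" "grouplike_mod_e1 q"
  shows "grouplike_mod_e1 (p * q :: 'k H8)"
proof -
  let ?E = "1 \<otimes>\<^sub>k e0 :: d8 \<times> d8 \<Rightarrow>\<^sub>0 'k"
  have E: "?E * comult p = (?E * comult p) * ?E"
    using assms(1) unfolding grouplike_mod_e1_def
    by (simp add: tensor_mult_tensor e_central(1)[of p] mult.assoc e_idem(1)[OF two])
  have "?E * comult (p * q) = (?E * comult p) * comult q"
    by (simp only: comult_hom(4)[OF two] mult.assoc)
  also have "\<dots> = ((?E * comult p) * ?E) * comult q"
    using E by (rule arg_cong)
  also have "\<dots> = (?E * comult p) * (?E * comult q)"
    by (simp only: mult.assoc)
  also have "\<dots> = (p * q) \<otimes>\<^sub>k (e0 * p * e0 * q)"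
    using assms unfolding grouplike_mod_e1_def by (simp add: tensor_mult_tensor mult.assoc)
  also have "e0 * p * e0 * q = e0 * (p * q)"
    by (simp only: mult.assoc e_central(1)[of p, symmetric] e_central(1)[of p, symmetric, THEN left_assoc]
        e_idem(1)[OF two, THEN left_assoc])
  finally show ?thesis
    unfolding grouplike_mod_e1_def .
qed

text \<open>
  The coproducts of \<open>t\<close> and \<open>w\<close> differ from \<open>t \<otimes> t\<close> and \<open>w \<otimes> w\<close> only in the terms whose
  right-hand factor contains \<open>e\<^sub>1\<close>, and \<open>1 \<otimes> e\<^sub>0\<close> annihilates these.
\<close>

lemma grouplike_mod_e1_gens: "grouplike_mod_e1 (gen_t :: 'k H8)" "grouplike_mod_e1 (gen_w :: 'k H8)"
  unfolding grouplike_mod_e1_def comult_hom(5,6)[OF two]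
  by (simp_all add: distrib_left tensor_mult_tensor e_idem(1-4)[OF two]
      e_idem(1-4)[OF two, THEN left_assoc] tensor_zero_right)

lemma grouplike_mod_e1_single: "grouplike_mod_e1 (Poly_Mapping.single x 1 :: 'k H8)"
proof -
  have "grouplike_mod_e1 (gen_w ^ n :: 'k H8)" for n
    by (induction n) (simp_all add: grouplike_mod_e1_one grouplike_mod_e1_mult grouplike_mod_e1_gens)
  then show ?thesis
    by (cases x) (simp_all only: single_Rot single_Refl grouplike_mod_e1_mult grouplike_mod_e1_gens)
qed

text \<open>
  The coaction of the group algebra of \<open>D\<^sub>8/\<langle>z\<rangle>\<close> that corresponds to the grading of \<open>kD\<^sub>8\<close>.
\<close>

lemma coaction:
  "(1 \<otimes>\<^sub>k e0) * comult p = (\<Sum>x\<in>UNIV. scale (Poly_Mapping.lookup p x)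
     (Poly_Mapping.single x 1 \<otimes>\<^sub>k (e0 * Poly_Mapping.single x 1)))"
  for p :: "'k H8"
proof -
  have zero: "comult (0 :: 'k H8) = 0"
    using comult_hom(3)[OF two, of 0 0] by simp
  have sum: "comult (sum f A) = (\<Sum>x\<in>A. comult (f x :: 'k H8))" if "finite A" for f and A :: "d8 set"
    using that by induction (simp_all add: comult_hom(2)[OF two] zero)
  show ?thesis
    by (subst poly_mapping_sum_singles[of p], subst single_eq_scale)
      (simp only: sum finite comult_hom(3)[OF two] sum_distrib_left scale_mult_right
        grouplike_mod_e1_single[unfolded grouplike_mod_e1_def])
qed

text \<open>
  Compare the components in \<open>x \<otimes> kD\<^sub>8\<close> of the two sides of the defining equation: they
  are \<open>p\<^sub>x (x \<otimes> e\<^sub>0 x)\<close> and \<open>p\<^sub>x (x \<otimes> e\<^sub>0 p)\<close>.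
\<close>

lemma grouplike_mod_e1_support:
  assumes p: "grouplike_mod_e1 (p :: 'k H8)" and x: "Poly_Mapping.lookup p x \<noteq> 0"
  shows "e0 * p = e0 * Poly_Mapping.single x 1"
proof (rule poly_mapping_eqI)
  fix v
  let ?c = "\<lambda>y. Poly_Mapping.lookup p y" and ?e = "\<lambda>y. e0 * Poly_Mapping.single y (1::'k)"
  have "?c x * Poly_Mapping.lookup (e0 * p) v = Poly_Mapping.lookup ((1 \<otimes>\<^sub>k e0) * comult p) (x, v)"
    using p by (simp add: grouplike_mod_e1_def lookup_tensor)
  also have "\<dots> = (\<Sum>y\<in>UNIV. if y = x then ?c x * Poly_Mapping.lookup (?e x) v else 0)"
    unfolding coaction lookup_sum
    by (intro sum.cong) (auto simp: lookup_tensor lookup_single when_def)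
  also have "\<dots> = ?c x * Poly_Mapping.lookup (?e x) v"
    by simp
  finally show "Poly_Mapping.lookup (e0 * p) v = Poly_Mapping.lookup (?e x) v"
    using x by simp
qed

lemma e0_single_eq_iff:
  "e0 * Poly_Mapping.single x 1 = e0 * Poly_Mapping.single y (1::'k) \<longleftrightarrow> y = x \<or> y = Rot 2 + x"
proof -
  have e0_x: "e0 * Poly_Mapping.single x (1::'k) =
      Poly_Mapping.single x (1/2) + Poly_Mapping.single (Rot 2 + x) (1/2)" for x
    by (simp add: e_eq distrib_right mult_single flip: zero_d8_def)
  have inv: "Rot 2 + (Rot 2 + x) = x" for x
    by (simp add: numerals_4 flip: add.assoc zero_d8_def)
  show ?thesis
  proof
    assume *: "e0 * Poly_Mapping.single x 1 = e0 * Poly_Mapping.single y (1::'k)"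
    have "Poly_Mapping.lookup (e0 * Poly_Mapping.single y (1::'k)) y \<noteq> 0"
      using two unfolding e0_x by (cases y) (simp_all add: lookup_add lookup_single)
    then show "y = x \<or> y = Rot 2 + x"
      unfolding *[symmetric] unfolding e0_x by (auto simp: lookup_add lookup_single when_def split: if_splits)
  next
    assume "y = x \<or> y = Rot 2 + x"
    then show "e0 * Poly_Mapping.single x 1 = e0 * Poly_Mapping.single y (1::'k)"
      unfolding e0_x by (auto simp: inv add.commute)
  qed
qed

text \<open>
  The elements \<open>1, w, t, wt\<close> represent the cosets of \<open>\<langle>z\<rangle>\<close>.
\<close>

lemma single_mod_gen_z:
  obtains "Poly_Mapping.single x (1::'k) \<in> {1, gen_w, gen_t, gen_w * gen_t}" |
    y where "Poly_Mapping.single x (1::'k) = gen_z * y" "y \<in> {1, gen_w, gen_t, gen_w * gen_t}"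
proof -
  have i: "i \<in> {0, 1, 2, 3}" for i :: 4
    by (simp only: UNIV_4 [symmetric] UNIV_I)
  have pow: "gen_w ^ 2 = gen_z * 1" "gen_w ^ 3 = gen_z * gen_w"
    by (simp_all add: gen_z_def numeral_eq_Suc mult.assoc)
  show thesis
  proof (cases x)
    case (Rot j)
    then show thesis
      using i[of j] that(1) that(2)[of 1] that(2)[of gen_w] unfolding Rot single_Rot
      by (auto simp: pow bit0.Rep_numeral bit0.Rep_0 bit0.Rep_1)
  next
    case (Refl j)
    then show thesis
      using i[of j] that(1) that(2)[of gen_t] that(2)[of "gen_w * gen_t"] unfolding Refl single_Refl
      by (auto simp: pow bit0.Rep_numeral bit0.Rep_0 bit0.Rep_1 mult.assoc)
  qed
qed

text \<open>
  All group elements in the support of \<open>p\<close> agree after multiplication with \<open>e\<^sub>0\<close>, so they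
  form one coset \<open>{x, zx}\<close> and \<open>p = (a + b z) x\<close>. In the block of \<open>e\<^sub>0\<close> this is \<open>x\<close>; in the block of \<open>e\<^sub>1\<close>,
  where \<open>z\<close> acts as \<open>-1\<close>, it is \<open>(a - b) x\<close>.
\<close>

lemma grouplike_mod_e1_cases:
  assumes p: "grouplike_mod_e1 (p :: 'k H8)" and "p \<noteq> 0"
  obtains x c where "x \<in> {1, gen_w, gen_t, gen_w * gen_t}" "e0 * p = e0 * x" "e1 * p = scale c (e1 * x)"
proof -
  obtain x where x: "Poly_Mapping.lookup p x \<noteq> 0"
    using \<open>p \<noteq> 0\<close> by (metis lookup_zero poly_mapping_eqI)
  let ?x = "Poly_Mapping.single x (1::'k)"
  let ?a = "Poly_Mapping.lookup p x" and ?b = "Poly_Mapping.lookup p (Rot 2 + x)"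
  note e0p = grouplike_mod_e1_support[OF p x]
  have "y = x \<or> y = Rot 2 + x" if "Poly_Mapping.lookup p y \<noteq> 0" for y
    using e0p grouplike_mod_e1_support[OF p that] e0_single_eq_iff by metis
  moreover have "Rot 2 + x \<noteq> x"
    by (cases x) auto
  ultimately have "p = Poly_Mapping.single x ?a + Poly_Mapping.single (Rot 2 + x) ?b"
    by (intro poly_mapping_eqI) (auto simp: lookup_add lookup_single when_def)
  also have "Poly_Mapping.single (Rot 2 + x) ?b = scale ?b (gen_z * ?x)"
    by (subst single_eq_scale) (simp add: gen_z_def gen_w_power mult_single)
  also have "Poly_Mapping.single x ?a = scale ?a ?x"
    by (rule single_eq_scale)
  finally have "e1 * p = e1 * (scale ?a ?x + scale ?b (gen_z * ?x))"
    by (rule arg_cong)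
  also have "\<dots> = scale (?a - ?b) (e1 * ?x)"
    by (simp add: distrib_left scale_mult_right normal_form_e[THEN left_assoc] scale_minus scale_diff_left)
  finally have e1p: "e1 * p = scale (?a - ?b) (e1 * ?x)" .
  \<comment> \<open>Replacing \<open>x\<close> by \<open>zx\<close> changes the sign of the scalar and nothing else.\<close>
  note result = that
  have red: thesis if "?x = gen_z * y" "y \<in> {1, gen_w, gen_t, gen_w * gen_t}" for y
  proof (rule result)
    show "y \<in> {1, gen_w, gen_t, gen_w * gen_t}" by fact
    show "e0 * p = e0 * y"
      unfolding e0p that(1) by (simp add: normal_form_e[THEN left_assoc])
    show "e1 * p = scale (?b - ?a) (e1 * y)"
      unfolding e1p that(1) by (simp add: normal_form_e[THEN left_assoc] scale_minus scale_diff_left)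
  qed
  show thesis
    using single_mod_gen_z[of x] e0p e1p result red by metis
qed

end

section \<open>Algebra homomorphisms\<close>

definition alg_hom :: "('k::field H8 \<Rightarrow> 'k H8) \<Rightarrow> bool" where
  "alg_hom f \<longleftrightarrow> f 1 = 1 \<and> (\<forall>p q. f (p + q) = f p + f q) \<and>
     (\<forall>c p. f (scale c p) = scale c (f p)) \<and> (\<forall>p q. f (p * q) = f p * f q)"

lemma alg_homD:
  assumes "alg_hom f"
  shows "f 1 = 1" "f (p + q) = f p + f q" "f (scale c p) = scale c (f p)" "f (p * q) = f p * f q"
    "f 0 = 0" "f (- p) = - f p" "f (p - q) = f p - f q"
proof -
  show 1: "f 1 = 1" "f (p + q) = f p + f q" "f (scale c p) = scale c (f p)" "f (p * q) = f p * f q"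
    for p q c
    using assms unfolding alg_hom_def by blast+
  show 0: "f 0 = 0"
    using 1(3)[of 0 0] by simp
  show 2: "f (- p) = - f p" for p
    using 1(2)[of p "- p"] 0 by (simp add: eq_neg_iff_add_eq_0 add.commute)
  show "f (p - q) = f p - f q"
    using 1(2)[of p "- q"] 2 by simp
qed

lemma alg_hom_eqI:
  assumes f: "alg_hom f" and g: "alg_hom g" and "f gen_t = g gen_t" "f gen_w = g gen_w"
  shows "f = g"
proof
  show "f p = g p" for p
    by (induction p rule: H8_induct) (simp_all add: assms(3,4) alg_homD[OF f] alg_homD[OF g])
qed

lemma alg_hom_linear:
  assumes "alg_hom f"
  shows "Vector_Spaces.linear scale scale f"
  unfolding Vector_Spaces.linear_iff using vector_space_scale alg_homD(2,3)[OF assms] by blast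

lemma alg_hom_comp: "alg_hom f \<Longrightarrow> alg_hom g \<Longrightarrow> alg_hom (f \<circ> g)"
  by (simp add: alg_hom_def)

lemma alg_hom_id: "alg_hom id"
  by (simp add: alg_hom_def)

lemma alg_hom_e:
  assumes f: "alg_hom f" and z: "f gen_z = gen_z"
  shows "f e0 = e0" "f e1 = e1"
  using z by (simp_all add: e0_def e1_def alg_homD[OF f] gen_z_def)

section \<open>Tensor products of homomorphisms\<close>

lemma tensor_induct [case_names tensor add]:
  assumes "\<And>p q. P (p \<otimes>\<^sub>k q)" and add: "\<And>r s. P r \<Longrightarrow> P s \<Longrightarrow> P (r + s)"
  shows "P (r :: 'a::finite \<times> 'b::finite \<Rightarrow>\<^sub>0 'k::semiring_1)"
proof -
  have sum: "P (sum f A)" if "finite A" "\<And>x. P (f x)" for f and A :: "('a \<times> 'b) set"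
    using that
  proof induction
    case empty
    show ?case
      using assms(1)[of 0 0] by (simp add: tensor_zero_left)
  qed (simp add: add)
  have "P (Poly_Mapping.single x c)" for x c
    using assms(1)[of "Poly_Mapping.single (fst x) c" "Poly_Mapping.single (snd x) 1"]
    by (simp add: tensor_single)
  then show ?thesis
    by (subst poly_mapping_sum_singles) (intro sum finite)
qed

lemma tensor_map_add: "tensor_map f g (r + s) = tensor_map f g r + tensor_map f g s"
  unfolding tensor_map_def
  by (rule poly_mapping_eqI) (simp add: lookup_sum lookup_add distrib_right sum.distrib)

lemma tensor_map_scale: "tensor_map f g (scale c r) = scale c (tensor_map f g r)"
  unfolding tensor_map_def
  by (rule poly_mapping_eqI) (simp add: lookup_sum mult.assoc sum_distrib_left)

lemma tensor_map_mult:
  assumes f: "alg_hom f" and g: "alg_hom g"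
  shows "tensor_map f g (r * s) = tensor_map f g r * tensor_map f g s"
proof (induction r rule: tensor_induct)
  case (tensor p q)
  show ?case
    by (induction s rule: tensor_induct)
      (simp_all add: distrib_left tensor_map_add tensor_mult_tensor alg_homD(4)[OF f] alg_homD(4)[OF g]
        tensor_map_tensor[OF alg_hom_linear[OF f] alg_hom_linear[OF g]])
qed (simp add: distrib_right tensor_map_add)

section \<open>Recognising Hopf automorphisms on generators\<close>

lemma hopf_aut_alg_hom:
  assumes "hopf_aut f"
  shows "alg_hom f"
proof -
  interpret f: Vector_Spaces.linear scale scale f
    using assms unfolding hopf_aut_def by blast
  show ?thesis
    using assms unfolding hopf_aut_def alg_hom_def by (simp add: f.add f.scale)
qed

lemma hopf_autI:
  fixes f :: "'k::field H8 \<Rightarrow> 'k H8"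
  assumes two: "(2::'k) \<noteq> 0" and f: "alg_hom f" and bij: "bij f"
    and comult: "\<And>p. p \<in> {gen_t, gen_w} \<Longrightarrow> comult (f p) = tensor_map f f (comult p)"
    and counit: "\<And>p. p \<in> {gen_t, gen_w} \<Longrightarrow> counit (f p) = counit p"
    and antipode: "\<And>p. p \<in> {gen_t, gen_w} \<Longrightarrow> antipode (f p) = f (antipode p)"
  shows "hopf_aut f"
proof -
  have "tensor_map f f 1 = 1"
    using tensor_map_tensor[OF alg_hom_linear[OF f] alg_hom_linear[OF f], of 1 1]
    by (simp add: tensor_one alg_homD(1)[OF f])
  then have "comult (f p) = tensor_map f f (comult p)" for p
    by (induction p rule: H8_induct)
      (simp_all add: comult comult_hom(1-4)[OF two] alg_homD[OF f]
        tensor_map_add tensor_map_scale tensor_map_mult[OF f f])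
  moreover have "counit (f p) = counit p" for p
    by (induction p rule: H8_induct)
      (simp_all add: counit counit_hom(1-4) alg_homD[OF f])
  moreover have "antipode (f p) = f (antipode p)" for p
    by (induction p rule: H8_induct)
      (simp_all add: antipode antipode_anti_hom(1-4)[OF two] alg_homD[OF f])
  ultimately show ?thesis
    using bij alg_hom_linear[OF f] alg_homD[OF f] unfolding hopf_aut_def by blast
qed

lemma hopf_aut_id:
  assumes two: "(2::'k::field) \<noteq> 0"
  shows "hopf_aut (id :: 'k H8 \<Rightarrow> 'k H8)"
proof (rule hopf_autI[OF two alg_hom_id bij_id])
  fix p :: "'k H8"
  have "tensor_map id id r = r" for r :: "d8 \<times> d8 \<Rightarrow>\<^sub>0 'k"
  proof (induction r rule: tensor_induct)
    case (tensor p q)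
    show ?case
      by (subst tensor_map_tensor) (simp_all only: alg_hom_linear[OF alg_hom_id] id_apply)
  qed (simp only: tensor_map_add)
  then show "comult (id p) = tensor_map id id (comult p)"
    by simp
qed simp_all

lemma hopf_aut_comp:
  assumes f: "hopf_aut f" and g: "hopf_aut g"
  shows "hopf_aut (f \<circ> g)"
proof -
  note lin = alg_hom_linear[OF hopf_aut_alg_hom[OF f]] alg_hom_linear[OF hopf_aut_alg_hom[OF g]]
    alg_hom_linear[OF alg_hom_comp[OF hopf_aut_alg_hom[OF f] hopf_aut_alg_hom[OF g]]]
  have "tensor_map f f (tensor_map g g r) = tensor_map (f \<circ> g) (f \<circ> g) r" for r
  proof (induction r rule: tensor_induct)
    case (tensor p q)
    show ?case
      unfolding tensor_map_tensor[OF lin(1) lin(1)] tensor_map_tensor[OF lin(2) lin(2)]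
        tensor_map_tensor[OF lin(3) lin(3)] by simp
  qed (simp only: tensor_map_add)
  then show ?thesis
    using f g bij_comp[of g f] lin(3) unfolding hopf_aut_def by simp
qed

section \<open>The values of a Hopf automorphism on the generators\<close>

locale hopf_automorphism =
  fixes f :: "'k::field H8 \<Rightarrow> 'k H8"
  assumes f: "hopf_aut f" and two: "(2::'k) \<noteq> 0"
begin

lemmas hom = alg_homD[OF hopf_aut_alg_hom[OF f]]

lemma inject: "f p = f q \<longleftrightarrow> p = q"
  using f unfolding hopf_aut_def by (metis bij_is_inj injD)

lemma comult_f: "comult (f p) = tensor_map f f (comult p)"
  and antipode_f: "antipode (f p) = f (antipode p)"
  using f unfolding hopf_aut_def by blast+

lemma tensor_map_f: "tensor_map f f (p \<otimes>\<^sub>k q) = f p \<otimes>\<^sub>k f q"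
  using tensor_map_tensor alg_hom_linear[OF hopf_aut_alg_hom[OF f]] by blast

lemma invertible_image:
  assumes "p * q = 1" "e1 * f p = scale c x"
  shows "c \<noteq> 0"
proof -
  have "f p * f q = 1"
    using assms(1) by (simp add: hom(1) flip: hom(4))
  then show ?thesis
    using e1_mult_nonzero[OF two, of "f p" "f q"] assms(2) by auto
qed

text \<open>
  The image of \<open>z\<close> is group-like and therefore has the normal form \<open>e\<^sub>0 x + c e\<^sub>1 x\<close>. It is
  central, which leaves \<open>x = 1\<close>, since each of \<open>w, t, wt\<close> anticommutes with \<open>t\<close> or \<open>w\<close> in the block of
  \<open>e\<^sub>1\<close>. Its square is \<open>1\<close>, so \<open>c = \<plusminus>1\<close>, and \<open>c = 1\<close> would give \<open>f(z) = 1\<close>.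
\<close>

lemma f_gen_z: "f gen_z = gen_z"
proof -
  let ?Z = "f gen_z"
  have ZZ: "?Z * ?Z = 1"
    by (simp add: normal_form hom(1) flip: hom(4))
  have central: "?Z * q = q * ?Z" for q
  proof -
    obtain r where "q = f r"
      using f unfolding hopf_aut_def by (metis bij_pointE)
    then show ?thesis
      by (metis hom(4) gen_z_central[OF two])
  qed
  have "grouplike_mod_e1 ?Z"
    by (simp add: grouplike_mod_e1_def comult_f comult_gen_z[OF two] tensor_map_f tensor_mult_tensor)
  moreover have "?Z \<noteq> 0"
    using ZZ by auto
  ultimately obtain x c where x: "x \<in> {1, gen_w, gen_t, gen_w * gen_t}"
    and Z0: "e0 * ?Z = e0 * x" and Z1: "e1 * ?Z = scale c (e1 * x)"
    using grouplike_mod_e1_cases[OF two] by metis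
  have c: "c \<noteq> 0"
    using invertible_image[OF normal_form(6) Z1] .
  have commute: "e1 * (x * y) = e1 * (y * x)" for y
  proof -
    have "scale c (e1 * (x * y)) = (e1 * ?Z) * y"
      by (simp add: Z1 scale_mult_left mult.assoc)
    also have "\<dots> = y * (e1 * ?Z)"
      by (metis central e_central(2) mult.assoc)
    also have "\<dots> = scale c (e1 * (y * x))"
      by (simp add: Z1 scale_mult_right) (simp add: e_central(2) mult.assoc)
    finally show ?thesis
      using c by (simp add: scale_cancel_left)
  qed
  have "x = 1"
  proof (rule ccontr)
    assume "x \<noteq> 1"
    moreover have "gen_z * gen_z = (1 :: 'k H8)" "gen_t * gen_t = (1 :: 'k H8)"
      "(gen_w * gen_t) * (gen_w * gen_t) = (1 :: 'k H8)"
      by (simp_all add: normal_form_rules)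
    ultimately show False
      using x commute[of gen_t] commute[of gen_w]
        e1_neq_minus[OF two, of "gen_w * gen_t" "gen_w * gen_t"] e1_neq_minus[OF two, of gen_t gen_t]
      by (auto simp: normal_form_rules)
  qed
  then have "scale (c * c) e1 = scale 1 (e1 :: 'k H8)"
    using e1_square[OF two Z1] by (simp add: ZZ)
  then have "c = 1 \<or> c = - 1"
    using e1_nonzero[OF two] by (simp add: scale_cancel_right square_eq_1_iff del: scale_one)
  moreover have "c \<noteq> 1"
  proof
    assume "c = 1"
    then have "?Z = f 1"
      using Z0 Z1 \<open>x = 1\<close> by (simp add: hom(1) eq_iff_block_eq[OF two, of ?Z])
    then show False
      using gen_z_not_one[OF two] by (simp add: inject)
  qed
  ultimately have "c = - 1"
    by simp
  then show ?thesis
    using Z0 Z1 \<open>x = 1\<close> by (simp add: eq_iff_block_eq[OF two, of ?Z] normal_form_e scale_minus)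
qed

lemmas f_e = alg_hom_e[OF hopf_aut_alg_hom[OF f] f_gen_z]

text \<open>
  The condition refers to \<open>e\<^sub>0\<close>, so this needs that \<open>f\<close> fixes \<open>e\<^sub>0\<close>.
\<close>

lemma grouplike_mod_e1_image:
  assumes "grouplike_mod_e1 p"
  shows "grouplike_mod_e1 (f p)"
proof -
  have "(1 \<otimes>\<^sub>k e0) * comult (f p) = tensor_map f f ((1 \<otimes>\<^sub>k e0) * comult p)"
    by (simp add: comult_f tensor_map_f tensor_map_mult hopf_aut_alg_hom[OF f] f_e hom(1))
  then show ?thesis
    using assms by (simp add: grouplike_mod_e1_def tensor_map_f hom(4) f_e)
qed

lemma image_cases:
  assumes "grouplike_mod_e1 p" "p * q = 1"
  obtains x c where "x \<in> {1, gen_w, gen_t, gen_w * gen_t}" "e0 * f p = e0 * x"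
    "e1 * f p = scale c (e1 * x)" "c \<noteq> 0"
proof -
  have "p \<noteq> 0"
    using assms(2) by auto
  then have "f p \<noteq> 0"
    using inject[of p 0] by (simp add: hom)
  then show thesis
    using grouplike_mod_e1_cases[OF two grouplike_mod_e1_image[OF assms(1)]]
      invertible_image[OF assms(2)] that by metis
qed

lemma images_not_commute: "f gen_w * f gen_t \<noteq> f gen_t * f gen_w"
  using gens_not_commute[OF two] by (simp add: inject flip: hom(4))

text \<open>
  In the normal form of \<open>f(w)\<close>, the choice \<open>x = 1\<close> would make \<open>f(w)\<close> central, and \<open>t\<close> and \<open>wt\<close>
  are not fixed by the antipode in the block of \<open>e\<^sub>1\<close>. So \<open>x = w\<close>, and \<open>f(w)\<^sup>2 = z\<close> gives \<open>c = \<plusminus>1\<close>.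
\<close>

lemma f_gen_w: "f gen_w = gen_w \<or> f gen_w = gen_w_inv"
proof -
  let ?W = "f gen_w"
  have WW: "?W * ?W = gen_z"
    by (simp add: normal_form f_gen_z flip: hom(4))
  obtain x c where x: "x \<in> {1, gen_w, gen_t, gen_w * gen_t}"
    and W0: "e0 * ?W = e0 * x" and W1: "e1 * ?W = scale c (e1 * x)" and c: "c \<noteq> 0"
    by (rule image_cases[OF grouplike_mod_e1_gens(2)[OF two] gen_rels(4)])
  have "x \<noteq> 1"
  proof
    assume "x = 1"
    then have "?W = e0 + scale c e1"
      using W0 W1 by (simp add: eq_iff_block_eq[OF two, of ?W] distrib_left scale_mult_right e_idem(1-4)[OF two])
    then have "?W * p = p * ?W" for p
      by (simp add: distrib_left distrib_right scale_mult_left scale_mult_right e_central)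
    then show False
      using images_not_commute by blast
  qed
  moreover have "x \<noteq> gen_t \<and> x \<noteq> gen_w * gen_t"
  proof -
    have "scale c (antipode (e1 * x)) = antipode (e1 * ?W)"
      by (simp add: W1 antipode_anti_hom(3)[OF two])
    also have "\<dots> = scale c (e1 * x)"
      by (simp only: antipode_e1_mult[OF two] antipode_f antipode_anti_hom(6)[OF two]) (rule W1)
    finally have "antipode (e1 * x) = e1 * x"
      using c by (simp add: scale_cancel_left)
    then show ?thesis
      using e1_refl_neq[OF two] minus_equation_iff[of "e1 * gen_t" "e1 * (gen_w * gen_t) :: 'k H8"]
      by (auto simp: antipode_e1_refl[OF two])
  qed
  ultimately have [simp]: "x = gen_w"
    using x by blast
  have "scale (c * c) (- e1) = scale 1 (- e1 :: 'k H8)"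
    using e1_square[OF two W1] by (simp add: WW normal_form normal_form_e)
  then have "c = 1 \<or> c = - 1"
    using e1_nonzero[OF two] by (simp add: scale_cancel_right square_eq_1_iff del: scale_one)
  then show ?thesis
    using W0 W1 by (auto simp: eq_iff_block_eq[OF two, of ?W] normal_form_rules scale_minus)
qed

text \<open>
  In the normal form of \<open>f(t)\<close>, the choices \<open>x = 1\<close> and \<open>x = w\<close> would make \<open>f(t)\<close> commute with
  \<open>f(w)\<close>, and \<open>f(t)\<^sup>2 = 1\<close> gives \<open>c = \<plusminus>1\<close>. The equation \<open>S(f(t)) = f(S(t))\<close> becomes
  \<open>S(e\<^sub>1 x) = - f(w) e\<^sub>1 x\<close>. For \<open>x = t\<close> the left-hand side is \<open>- e\<^sub>1 w t\<close>, so \<open>f(w) = w\<close>; for \<open>x = wt\<close> it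
  is \<open>- e\<^sub>1 t\<close>, so \<open>f(w) = w\<^sup>3\<close>.
\<close>

lemma f_gens:
  "f gen_w = gen_w \<and> f gen_t \<in> {gen_t, gen_z * gen_t} \<or>
   f gen_w = gen_w_inv \<and> f gen_t \<in> {gen_w * gen_t, gen_w_inv * gen_t}"
proof -
  let ?W = "f gen_w" and ?T = "f gen_t"
  have TT: "?T * ?T = 1"
    by (simp add: normal_form hom(1) flip: hom(4))
  obtain x c where x: "x \<in> {1, gen_w, gen_t, gen_w * gen_t}"
    and T0: "e0 * ?T = e0 * x" and T1: "e1 * ?T = scale c (e1 * x)" and c: "c \<noteq> 0"
    by (rule image_cases[OF grouplike_mod_e1_gens(1)[OF two] normal_form(2)])
  have T: "?T = (e0 + scale c e1) * x"
    using T0 T1 by (simp add: eq_iff_block_eq[OF two, of ?T] distrib_left distrib_right scale_mult_left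
        scale_mult_right e_idem(1-4)[OF two] e_idem(1-4)[OF two, THEN left_assoc])
  have "x \<noteq> 1 \<and> x \<noteq> gen_w"
  proof (rule ccontr)
    assume "\<not> (x \<noteq> 1 \<and> x \<noteq> gen_w)"
    then have "?W * ?T = ?T * ?W"
      using f_gen_w unfolding T
      by (auto simp: normal_form_rules scale_mult_left scale_mult_right scale_minus)
    then show False
      using images_not_commute by blast
  qed
  then have x: "x = gen_t \<or> x = gen_w * gen_t"
    using x by blast
  have "scale c (antipode (e1 * x)) = antipode (e1 * ?T)"
    by (simp add: T1 antipode_anti_hom(3)[OF two])
  also have "\<dots> = e1 * f (antipode gen_t)"
    by (simp add: antipode_e1_mult[OF two] antipode_f)
  also have "\<dots> = - (e1 * ?W * ?T)"
    by (simp add: antipode_anti_hom(5)[OF two] hom f_e right_diff_distrib left_diff_distrib mult.assoc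
      e_idem(1-4)[OF two] e_idem(1-4)[OF two, THEN left_assoc])
  also have "\<dots> = scale c (- (?W * (e1 * x)))"
    by (simp add: e_central(2)[of ?W] mult.assoc T1 scale_mult_right scale_minus)
  finally have S: "antipode (e1 * x) = - (?W * (e1 * x))"
    using c by (simp add: scale_cancel_left)
  have "x * x = 1"
    using x by (auto simp: normal_form_rules)
  then have "scale (c * c) e1 = scale 1 (e1 :: 'k H8)"
    using e1_square[OF two T1] by (simp add: TT)
  then have "c = 1 \<or> c = - 1"
    using e1_nonzero[OF two] by (simp add: scale_cancel_right square_eq_1_iff del: scale_one)
  then have T_cases: "?T = x \<or> ?T = gen_z * x"
    using T0 T1 by (auto simp: eq_iff_block_eq[OF two, of ?T] normal_form_rules scale_minus)
  have units: "gen_t * gen_t = (1 :: 'k H8)" "(gen_w * gen_t) * (gen_w * gen_t) = (1 :: 'k H8)"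
    by (simp_all add: normal_form_rules)
  from x show ?thesis
  proof
    assume [simp]: "x = gen_t"
    have "?W \<noteq> gen_w_inv"
      using S e1_neq_minus[OF two units(2)]
      by (auto simp: antipode_e1_refl[OF two] normal_form_rules)
    then show ?thesis
      using f_gen_w T_cases by simp
  next
    assume [simp]: "x = gen_w * gen_t"
    have "?W \<noteq> gen_w"
      using S e1_neq_minus[OF two units(1)]
      by (auto simp: antipode_e1_refl[OF two] normal_form_rules)
    then show ?thesis
      using f_gen_w T_cases by (auto simp: gen_w_inv_eq mult.assoc)
  qed
qed

end

section \<open>The three nontrivial automorphisms\<close>

lemma alg_hom_f_pm: "alg_hom f_plus" "alg_hom f_minus" "alg_hom f_plus_minus"
proof -
  show 1: "alg_hom f_plus" "alg_hom f_minus"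
    unfolding alg_hom_def by (intro conjI allI f_plus_hom f_minus_hom)+
  then show "alg_hom f_plus_minus"
    unfolding f_plus_minus_def by (intro alg_hom_comp)
qed

lemma f_pm_gen_z:
  "f_plus gen_z = (gen_z :: 'k::field H8)" "f_minus gen_z = (gen_z :: 'k H8)"
  unfolding gen_z_def power2_eq_square f_plus_hom f_minus_hom by (simp_all add: normal_form_rules)

lemma f_plus_minus_gens:
  "f_plus_minus (gen_t :: 'k::field H8) = gen_z * gen_t" "f_plus_minus (gen_w :: 'k H8) = gen_w"
  unfolding f_plus_minus_def
  by (simp_all add: f_plus_hom f_minus_hom gen_w_inv_eq f_pm_gen_z) (simp_all add: normal_form_rules)

lemma f_plus_f_plus: "f_plus \<circ> f_plus = (id :: 'k::field H8 \<Rightarrow> 'k H8)"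
  and f_minus_f_minus: "f_minus \<circ> f_minus = (id :: 'k H8 \<Rightarrow> 'k H8)"
  and f_minus_f_plus: "f_minus \<circ> f_plus = (f_plus \<circ> f_minus :: 'k H8 \<Rightarrow> 'k H8)"
  by (rule alg_hom_eqI;
      simp add: alg_hom_comp alg_hom_f_pm alg_hom_id f_plus_hom f_minus_hom gen_w_inv_eq f_pm_gen_z;
      simp add: normal_form_rules)+

lemma hopf_aut_f_pm:
  assumes two: "(2::'k::field) \<noteq> 0"
  shows "hopf_aut (f_plus :: 'k H8 \<Rightarrow> 'k H8)" "hopf_aut (f_minus :: 'k H8 \<Rightarrow> 'k H8)"
    "hopf_aut (f_plus_minus :: 'k H8 \<Rightarrow> 'k H8)"
proof -
  note bij = o_bij[OF f_plus_f_plus f_plus_f_plus] o_bij[OF f_minus_f_minus f_minus_f_minus]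
  note f_e = alg_hom_e[OF alg_hom_f_pm(1) f_pm_gen_z(1)] alg_hom_e[OF alg_hom_f_pm(2) f_pm_gen_z(2)]
  note rules = normal_form_rules e_idem(1-4)[OF two] e_idem(1-4)[OF two, THEN left_assoc]
    tensor_mult_tensor tensor_add_left tensor_add_right tensor_minus_left tensor_minus_right
    tensor_zero_left tensor_zero_right comult_gen_z[OF two]
  show plus: "hopf_aut (f_plus :: 'k H8 \<Rightarrow> 'k H8)"
  proof (rule hopf_autI[OF two alg_hom_f_pm(1) bij(1)])
    fix p :: "'k H8"
    assume p: "p \<in> {gen_t, gen_w}"
    show "comult (f_plus p) = tensor_map f_plus f_plus (comult p)"
      using p by (auto simp: comult_hom[OF two] f_plus_hom tensor_map_add f_e f_pm_gen_z gen_w_inv_eq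
          tensor_map_tensor[OF alg_hom_linear[OF alg_hom_f_pm(1)] alg_hom_linear[OF alg_hom_f_pm(1)]])
        (simp_all add: rules)
    show "counit (f_plus p) = counit p"
      using p by (auto simp: counit_hom f_plus_hom gen_w_inv_eq gen_z_def power2_eq_square)
    show "antipode (f_plus p) = f_plus (antipode p)"
      using p by (auto simp: antipode_anti_hom[OF two] f_plus_hom alg_homD(7)[OF alg_hom_f_pm(1)]
          f_e f_pm_gen_z gen_w_inv_eq gen_z_def power2_eq_square) (simp_all add: rules)
  qed
  show minus: "hopf_aut (f_minus :: 'k H8 \<Rightarrow> 'k H8)"
  proof (rule hopf_autI[OF two alg_hom_f_pm(2) bij(2)])
    fix p :: "'k H8"
    assume p: "p \<in> {gen_t, gen_w}"
    show "comult (f_minus p) = tensor_map f_minus f_minus (comult p)"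
      using p by (auto simp: comult_hom[OF two] f_minus_hom tensor_map_add f_e f_pm_gen_z gen_w_inv_eq
          tensor_map_tensor[OF alg_hom_linear[OF alg_hom_f_pm(2)] alg_hom_linear[OF alg_hom_f_pm(2)]])
        (simp_all add: rules)
    show "counit (f_minus p) = counit p"
      using p by (auto simp: counit_hom f_minus_hom gen_w_inv_eq gen_z_def power2_eq_square)
    show "antipode (f_minus p) = f_minus (antipode p)"
      using p by (auto simp: antipode_anti_hom[OF two] f_minus_hom alg_homD(7)[OF alg_hom_f_pm(2)]
          f_e f_pm_gen_z gen_w_inv_eq gen_z_def power2_eq_square) (simp_all add: rules)
  qed
  show "hopf_aut (f_plus_minus :: 'k H8 \<Rightarrow> 'k H8)"
    unfolding f_plus_minus_def using plus minus by (rule hopf_aut_comp)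
qed

lemma hopf_aut_iff:
  assumes two: "(2::'k::field) \<noteq> 0"
  shows "hopf_aut (f :: 'k H8 \<Rightarrow> 'k H8) \<longleftrightarrow> f \<in> {id, f_plus, f_minus, f_plus_minus}"
proof
  assume f: "hopf_aut f"
  interpret hopf_automorphism f
    using f two by unfold_locales
  have "f = g" if "alg_hom g" "f gen_t = g gen_t" "f gen_w = g gen_w" for g
    using hopf_aut_alg_hom[OF f] that by (rule alg_hom_eqI)
  note eqI = this[OF alg_hom_id] this[OF alg_hom_f_pm(1)] this[OF alg_hom_f_pm(2)] this[OF alg_hom_f_pm(3)]
  show "f \<in> {id, f_plus, f_minus, f_plus_minus}"
    using f_gens eqI by (auto simp: f_plus_hom f_minus_hom f_plus_minus_gens)
next
  assume "f \<in> {id, f_plus, f_minus, f_plus_minus}"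
  then show "hopf_aut f"
    using hopf_aut_f_pm[OF two] hopf_aut_id[OF two] by blast
qed

section \<open>The group of Hopf automorphisms\<close>

text \<open>
  Every composite of \<open>f\<close> and \<open>g\<close> reduces to \<open>f\<^sup>a \<circ> g\<^sup>b\<close> with \<open>a, b \<in> {0, 1}\<close>. The four such maps are
  distinct, and \<open>(a, b) \<mapsto> f\<^sup>a \<circ> g\<^sup>b\<close> is the isomorphism.
\<close>

lemma klein_four_group:
  fixes f g :: "'a \<Rightarrow> 'a"
  assumes f: "f \<circ> f = id" and g: "g \<circ> g = id" and fg: "g \<circ> f = f \<circ> g"
    and "f \<noteq> id" "g \<noteq> id" "f \<noteq> g"
  defines "G \<equiv> \<lparr>carrier = {id, f, g, f \<circ> g}, monoid.mult = (\<circ>), one = id\<rparr>"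
  shows "group G" "G \<cong> integer_mod_group 2 \<times>\<times> integer_mod_group 2"
proof -
  have [simp]: "f (f x) = x" "g (g x) = x" "g (f x) = f (g x)" for x
    using f g fg by (simp_all add: fun_eq_iff)
  show group: "group G"
  proof (rule groupI)
    show "x \<otimes>\<^bsub>G\<^esub> y \<in> carrier G" if "x \<in> carrier G" "y \<in> carrier G" for x y
      using that unfolding G_def by (auto simp: fun_eq_iff)
    show "\<exists>y\<in>carrier G. y \<otimes>\<^bsub>G\<^esub> x = \<one>\<^bsub>G\<^esub>" if "x \<in> carrier G" for x
      using that unfolding G_def by (auto simp: fun_eq_iff)
  qed (simp_all add: G_def comp_assoc)
  let ?Z = "integer_mod_group 2 \<times>\<times> integer_mod_group 2"
  let ?h = "\<lambda>(a, b). (if a = 0 then id else f) \<circ> (if b = 0 then id else g)"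
  have Z: "carrier ?Z = {(0, 0), (0, 1), (1, 0), (1, 1)}"
    by (auto simp: carrier_integer_mod_group)
  have "f \<circ> g \<noteq> id" "f \<circ> g \<noteq> f" "f \<circ> g \<noteq> g"
    using assms(4-6) by (metis (no_types, lifting) comp_assoc comp_id f g id_comp)+
  then have "bij_betw ?h (carrier ?Z) (carrier G)"
    using assms(4-6) unfolding bij_betw_def Z G_def by (auto simp: inj_on_def)
  moreover have "?h \<in> hom ?Z G"
    unfolding hom_def Z by (auto simp: G_def fun_eq_iff mult_DirProd)
  ultimately have "?Z \<cong> G"
    by (intro is_isoI) (simp add: iso_def)
  then show "G \<cong> ?Z"
    by (rule group.iso_sym[OF DirProd_group[OF group_integer_mod_group group_integer_mod_group]])
qed

theorem lemma5p1:
  assumes "CHAR('k::alg_closed_field) \<noteq> 2"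
  shows "(\<forall>f :: 'k H8 \<Rightarrow> 'k H8. hopf_aut f \<longrightarrow> f \<in> {id, f_plus, f_minus, f_plus_minus}) \<and>
    group (Aut_H8 :: ('k H8 \<Rightarrow> 'k H8) monoid) \<and>
    carrier (Aut_H8 :: ('k H8 \<Rightarrow> 'k H8) monoid) = {id, f_plus, f_minus, f_plus_minus} \<and>
    (Aut_H8 :: ('k H8 \<Rightarrow> 'k H8) monoid) \<cong> integer_mod_group 2 \<times>\<times> integer_mod_group 2"
proof -
  have two: "(2::'k) \<noteq> 0"
  proof
    assume "(2::'k) = 0"
    then have "CHAR('k) dvd 2"
      using of_nat_eq_0_iff_char_dvd[of 2, where ?'a = 'k] by simp
    then show False
      using assms CHAR_not_1'[where ?'a = 'k] two_is_prime_nat unfolding prime_nat_iff by auto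
  qed
  have "carrier (Aut_H8 :: ('k H8 \<Rightarrow> 'k H8) monoid) = {id, f_plus, f_minus, f_plus_minus}"
    unfolding Aut_H8_def by (auto simp: hopf_aut_iff[OF two])
  then have Aut: "(Aut_H8 :: ('k H8 \<Rightarrow> 'k H8) monoid) =
      \<lparr>carrier = {id, f_plus, f_minus, f_plus \<circ> f_minus}, monoid.mult = (\<circ>), one = id\<rparr>"
    by (simp add: Aut_H8_def f_plus_minus_def)
  have neq: "f_plus \<noteq> (id :: 'k H8 \<Rightarrow> 'k H8)" "f_minus \<noteq> (id :: 'k H8 \<Rightarrow> 'k H8)"
    "f_plus \<noteq> (f_minus :: 'k H8 \<Rightarrow> 'k H8)"
  proof -
    have [simp]: "Poly_Mapping.single x (1::'k) = Poly_Mapping.single y 1 \<longleftrightarrow> x = y" for x y :: d8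
      by (metis lookup_single_eq lookup_single_not_eq zero_neq_one)
    have "f_plus gen_w \<noteq> (id gen_w :: 'k H8)" "f_minus gen_w \<noteq> (id gen_w :: 'k H8)"
      "f_plus gen_t \<noteq> (f_minus gen_t :: 'k H8)"
      unfolding f_plus_hom f_minus_hom unfolding gen_t_def gen_w_def gen_w_inv_def
      by (auto simp: mult_single numerals_4)
    then show "f_plus \<noteq> (id :: 'k H8 \<Rightarrow> 'k H8)" "f_minus \<noteq> (id :: 'k H8 \<Rightarrow> 'k H8)"
      "f_plus \<noteq> (f_minus :: 'k H8 \<Rightarrow> 'k H8)"
      by metis+
  qed
  show ?thesis
    using hopf_aut_iff[OF two] klein_four_group[OF f_plus_f_plus f_minus_f_minus f_minus_f_plus neq]
    unfolding Aut f_plus_minus_def by auto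
qed

end
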